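(* Let $f:[a,b]\to\mathbb{R}$ be continuous, and let $\pi_n$ be the unique minimizer of $\|\pi-f\|$ over $\pi\in\Pi_n$. Fix parameters $0<\beta^-<\beta^+<1$ and $0<\gamma^-\le1<\gamma^+$, and run the following algorithm. Initialisation: start with $\sigma(t)=\frac{t-a}{b-a}f(b)+\frac{t-b}{a-b}f(a)$ and with some $\beta\in[\beta^-,\beta^+]$. Main step: 1. Compute $M=\max_{t\in[a,b]}[\sigma(t)-f(t)]$ and $m=\min_{t\in[a,b]}[\sigma(t)-f(t)]$. 2. Replace $\sigma$ by $\sigma-\frac{M+m}{2}$. 3. Determine the $\beta$-alternance data $k(\beta),\varepsilon(\beta),t_i^\pm(\beta)$ of $\sigma-f$. 4. If $k(\beta)\ge n+1$ and $\beta=\beta^+$: stop and output $\hat\sigma=\sigma$. 5. If $k(\beta)\ge n+1$ and $\beta<\beta^+$: replace $\beta$ by $\min[\gamma^+\beta,\beta^+]$ and return to 3. 6. If $k(\beta)\le n$: set $\xi_i=\frac{t_i^+(\beta)+t_{i+1}^-(\beta)}{2}$ for $i=0,\dots,k(\beta)-1$ and $\gamma(t)=\varepsilon(\beta)\prod_{i=0}^{k(\beta)-1}(\xi_i-t)$; choose $\lambda>0$ such that $\|\sigma-f-\lambda\gamma\|<\frac{1+\beta\rho(\beta)}{1+\rho(\beta)}\|\sigma-f\|$ (such $\lambda$ exist); replace $\sigma$ by $\sigma-\lambda\gamma$ and $\beta$ by $\max[\beta^-,\gamma^-\beta]$, and return to 1. Then the algorithm converges in a finite number of steps to some $\hat\sigma\in\Pi_n$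 such that $k(\beta^+,\hat\sigma)\ge n+1$. Furthermore, $\beta^+\|\hat\sigma-f\|\le\|\pi_n-f\|$.
   Context: Let $a<b$; $\|g\|=\max_{t\in[a,b]}|g(t)|$; $\Pi_n$ is the set of real polynomial functions of degree at most $n$. For a continuous $g:[a,b]\to\mathbb{R}$ with $M:=\max_{[a,b]} g=-\min_{[a,b]} g>0$ and $\beta\in(0,1]$, the $\beta$-alternance data of $g$ are the uniquely determined integer $k(\beta)\ge1$, sign $\varepsilon(\beta)\in\{-1,1\}$ and points $t_i^-(\beta),t_i^+(\beta)\in[a,b]$, $i=0,\dots,k(\beta)$, such that - $a\le t_0^-(\beta)$, $t_{k(\beta)}^+(\beta)\le b$, $t_i^-(\beta)\le t_i^+(\beta)$ for all $i$, and $t_i^+(\beta)<t_{i+1}^-(\beta)$ for $i=0,\dots,k(\beta)-1$; - $-\beta M<\varepsilon(\beta)(-1)^i g(t)\le M$ for all $t\in[t_i^-(\beta),t_i^+(\beta)]$ and all $i$; - $\varepsilon(\beta)(-1)^i g(t_i^+(\beta))=\varepsilon(\beta)(-1)^{i+1}g(t_{i+1}^-(\beta))=\beta M$ for $i=0,\dots,k(\beta)-1$; - $\varepsilon(\beta)g(t_0^-(\beta))\ge\beta M$ and $\varepsilon(\beta)(-1)^{k(\beta)}g(t_{k(\beta)}^+(\beta))\ge\beta M$; - $|g(t)|<\beta M$ for all $t\in[a,b]$ outside $\bigcup_i[t_i^-(\beta),t_i^+(\beta)]$. In step 6, $\rho(\beta)=m_-(\beta)/m_+(\beta)$, where $m_-(\beta)=\min\{|\gamma(t)|: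 t\in\bigcup_i[t_i^-(\beta),t_i^+(\beta)]\}$ and $m_+(\beta)=\max\{|\gamma(t)|:t\in[a,b]\}$. For $\sigma\in\Pi_n$, $k(\beta,\sigma)$ denotes the integer $k(\beta)$ in the $\beta$-alternance data of $\sigma-\frac12\left[\max_{[a,b]}(\sigma-f)+\min_{[a,b]}(\sigma-f)\right]-f$.
   Formalization: The formal theorem assumes n ≥ 1 (for n = 0 the starting line need not lie in Π_0) and that f does not coincide on [a,b] with an element of Π_n (otherwise k(β) ≥ n+1 is never attained or the alternance data are undefined). *)

theory Defs
  imports "HOL-Analysis.Analysis" "HOL-Computational_Algebra.Polynomial"
begin

definition poly_funs :: "nat \<Rightarrow> (real \<Rightarrow> real) set" where
  "poly_funs n = {poly p | p :: real poly. degree p \<le> n}"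

text \<open>
  The suprema and infima below are only used for continuous functions on nonempty compact sets,
  where they are attained, that is, where they are maxima and minima.
\<close>

definition max_on :: "real \<Rightarrow> real \<Rightarrow> (real \<Rightarrow> real) \<Rightarrow> real" where
  "max_on a b g = (SUP t\<in>{a..b}. g t)"

definition min_on :: "real \<Rightarrow> real \<Rightarrow> (real \<Rightarrow> real) \<Rightarrow> real" where
  "min_on a b g = (INF t\<in>{a..b}. g t)"

definition max_norm :: "real \<Rightarrow> real \<Rightarrow> (real \<Rightarrow> real) \<Rightarrow> real" where
  "max_norm a b g = max_on a b (\<lambda>t. \<bar>g t\<bar>)"

definition best_approx ::
    "real \<Rightarrow> real \<Rightarrow> nat \<Rightarrow> (real \<Rightarrow> real) \<Rightarrow> (real \<Rightarrow> real) \<Rightarrow> bool" where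
  "best_approx a b n f p \<longleftrightarrow>
     p \<in> poly_funs n \<and>
     (\<forall>q\<in>poly_funs n. max_norm a b (\<lambda>t. p t - f t) \<le> max_norm a b (\<lambda>t. q t - f t))"

text \<open>
  \<open>alternance_data a b g \<beta> k \<epsilon> tm tp\<close>: the number \<open>k\<close>, the sign \<open>\<epsilon>\<close> and the points
  \<open>tm i\<close> (for $t_i^-$) and \<open>tp i\<close> (for $t_i^+$) are \<open>\<beta>\<close>-alternance data of \<open>g\<close>.
  Only the values \<open>tm i\<close>, \<open>tp i\<close> with \<open>i \<le> k\<close> matter. The first two lines express that the data are
  defined at all; in particular the zero function has no \<open>\<beta>\<close>-alternance data.
\<close>

definition alternance_data ::
    "real \<Rightarrow> real \<Rightarrow> (real \<Rightarrow> real) \<Rightarrow> real \<Rightarrow> nat \<Rightarrow> real \<Rightarrow> (nat \<Rightarrow> real) \<Rightarrow> (nat \<Rightarrow> real) \<Rightarrow> bool" where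
  "alternance_data a b g \<beta> k \<epsilon> tm tp \<longleftrightarrow>
    (let M = max_on a b g in
      continuous_on {a..b} g \<and> 0 < \<beta> \<and> \<beta> \<le> 1 \<and>
      M = - min_on a b g \<and> M > 0 \<and>
      k \<ge> 1 \<and> \<epsilon> \<in> {-1, 1} \<and>
      a \<le> tm 0 \<and> tp k \<le> b \<and> (\<forall>i\<le>k. tm i \<le> tp i) \<and> (\<forall>i<k. tp i < tm (i + 1)) \<and>
      (\<forall>i\<le>k. \<forall>t\<in>{tm i..tp i}. - \<beta> * M < \<epsilon> * (-1) ^ i * g t \<and> \<epsilon> * (-1) ^ i * g t \<le> M) \<and>
      (\<forall>i<k. \<epsilon> * (-1) ^ i * g (tp i) = \<beta> * M \<and> \<epsilon> * (-1) ^ (i + 1) * g (tm (i + 1)) = \<beta> * M) \<and>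
      \<epsilon> * g (tm 0) \<ge> \<beta> * M \<and> \<epsilon> * (-1) ^ k * g (tp k) \<ge> \<beta> * M \<and>
      (\<forall>t\<in>{a..b} - (\<Union>i\<le>k. {tm i..tp i}). \<bar>g t\<bar> < \<beta> * M))"

definition centre ::
    "real \<Rightarrow> real \<Rightarrow> (real \<Rightarrow> real) \<Rightarrow> (real \<Rightarrow> real) \<Rightarrow> (real \<Rightarrow> real)" where
  "centre a b f \<sigma> =
     (\<lambda>t. \<sigma> t - (max_on a b (\<lambda>s. \<sigma> s - f s) + min_on a b (\<lambda>s. \<sigma> s - f s)) / 2)"

definition alternance_number ::
    "real \<Rightarrow> real \<Rightarrow> (real \<Rightarrow> real) \<Rightarrow> real \<Rightarrow> (real \<Rightarrow> real) \<Rightarrow> nat" where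
  "alternance_number a b f \<beta> \<sigma> =
     (THE k. \<exists>\<epsilon> tm tp. alternance_data a b (\<lambda>t. centre a b f \<sigma> t - f t) \<beta> k \<epsilon> tm tp)"

definition initial_line :: "real \<Rightarrow> real \<Rightarrow> (real \<Rightarrow> real) \<Rightarrow> (real \<Rightarrow> real)" where
  "initial_line a b f = (\<lambda>t. (t - a) / (b - a) * f b + (t - b) / (a - b) * f a)"

definition descent_poly ::
    "nat \<Rightarrow> real \<Rightarrow> (nat \<Rightarrow> real) \<Rightarrow> (nat \<Rightarrow> real) \<Rightarrow> (real \<Rightarrow> real)" where
  "descent_poly k \<epsilon> tm tp = (\<lambda>t. \<epsilon> * (\<Prod>i<k. (tp i + tm (i + 1)) / 2 - t))"

definition descent_ratio ::
    "real \<Rightarrow> real \<Rightarrow> nat \<Rightarrow> (nat \<Rightarrow> real) \<Rightarrow> (nat \<Rightarrow> real) \<Rightarrow> (real \<Rightarrow> real) \<Rightarrow> real" where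
  "descent_ratio a b k tm tp \<gamma> =
     (INF t\<in>(\<Union>i\<le>k. {tm i..tp i}). \<bar>\<gamma> t\<bar>) / max_on a b (\<lambda>t. \<bar>\<gamma> t\<bar>)"

text \<open>
  The algorithm as a transition system on its program states: \<open>Main \<sigma> \<beta>\<close> is about to
  recentre \<open>\<sigma>\<close>, \<open>Inner \<sigma> \<beta>\<close> is about to determine the \<open>\<beta>\<close>-alternance data of \<open>\<sigma> - f\<close>, and \<open>Output \<sigma>\<close> has stopped with result \<open>\<sigma>\<close>.
  It is nondeterministic because of the free choice of the factor \<open>l\<close> in \<open>descend\<close>.
  After \<open>increase\<close> the loop resumes without recentring, since \<open>\<sigma>\<close> has not changed.
\<close>

datatype alg_state =
    Main "real \<Rightarrow> real" real
  | Inner "real \<Rightarrow> real" real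
  | Output "real \<Rightarrow> real"

inductive alg_step ::
    "real \<Rightarrow> real \<Rightarrow> (real \<Rightarrow> real) \<Rightarrow> nat \<Rightarrow> real \<Rightarrow> real \<Rightarrow> real \<Rightarrow> real \<Rightarrow> alg_state \<Rightarrow> alg_state \<Rightarrow> bool"
  for a b :: real and f :: "real \<Rightarrow> real" and n :: nat and \<beta>lo \<beta>hi \<gamma>lo \<gamma>hi :: real
where
  recentre: "alg_step a b f n \<beta>lo \<beta>hi \<gamma>lo \<gamma>hi (Main \<sigma> \<beta>) (Inner (centre a b f \<sigma>) \<beta>)"
| stop: "alg_step a b f n \<beta>lo \<beta>hi \<gamma>lo \<gamma>hi (Inner \<sigma> \<beta>) (Output \<sigma>)"
    if "alternance_data a b (\<lambda>t. \<sigma> t - f t) \<beta> k \<epsilon> tm tp" and "k \<ge> n + 1" and "\<beta> = \<beta>hi"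
| increase: "alg_step a b f n \<beta>lo \<beta>hi \<gamma>lo \<gamma>hi (Inner \<sigma> \<beta>) (Inner \<sigma> (min (\<gamma>hi * \<beta>) \<beta>hi))"
    if "alternance_data a b (\<lambda>t. \<sigma> t - f t) \<beta> k \<epsilon> tm tp" and "k \<ge> n + 1" and "\<beta> < \<beta>hi"
| descend: "alg_step a b f n \<beta>lo \<beta>hi \<gamma>lo \<gamma>hi
      (Inner \<sigma> \<beta>) (Main (\<lambda>t. \<sigma> t - l * \<gamma> t) (max \<beta>lo (\<gamma>lo * \<beta>)))"
    if "alternance_data a b (\<lambda>t. \<sigma> t - f t) \<beta> k \<epsilon> tm tp" and "k \<le> n"
      and "\<gamma> = descent_poly k \<epsilon> tm tp" and "\<rho> = descent_ratio a b k tm tp \<gamma>"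
      and "l > 0"
      and "max_norm a b (\<lambda>t. \<sigma> t - f t - l * \<gamma> t)
             < (1 + \<beta> * \<rho>) / (1 + \<rho>) * max_norm a b (\<lambda>t. \<sigma> t - f t)"

end

theory Submission
  imports Defs
begin

text \<open>
  Across the gap between two consecutive intervals of the alternance data, the error function
  changes by \<open>2 \<beta> M\<close>. All iterates lie in a bounded subset of the polynomials of degree at most
  \<open>n\<close>, which is equicontinuous, so these gaps, and with them \<open>\<rho>\<close>, stay away from zero. Every descent
  step therefore shrinks the error by a uniform factor below one. As the error never drops below that
  of the best approximation, which is positive, only finitely many descents occur, and between two
  of them \<open>\<beta>\<close> can be increased only finitely often. The final estimate is de la Vallee Poussin's:
  a better approximation would differ from the output by a polynomial of degree at most \<open>n\<close> with
  \<open>n + 1\<close> sign changes.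
\<close>

text \<open>The step length in \<open>descend\<close> is free, so uniformity can come only from the
  acceptance threshold \<open>(1 + \<beta> * \<rho>) / (1 + \<rho>)\<close>. It balances two bounds.
  Let m be the minimum of \<open>\<bar>\<gamma> t\<bar>\<close> on the intervals and mu its maximum
  on [a,b]. A step of length l that does not overshoot leaves an error of at most M - l m where the
  old error is at least \<beta> M, and at most \<beta> M + l mu elsewhere. Both bounds agree at l =
  (1 - \<beta>) M / (m + mu), where they equal the threshold times M. The clamp
  \<open>\<beta>lo\<close> keeps the change across a gap above 2 \<open>\<beta>lo\<close> E, with E
  the best error, however often \<beta> is reduced. As \<beta> may rise and fall repeatedly, no
  single quantity decreases throughout, hence a lexicographic rank. Because runs are
  nondeterministic, termination of every run, absence of stuck states and correctness of every
  output are three separate claims.\<close>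

section \<open>Extrema and the maximum norm on an interval\<close>

lemma max_on_attained:
  assumes "a \<le> b" "continuous_on {a..b} g"
  obtains t where "t \<in> {a..b}" "g t = max_on a b g"
proof -
  obtain t where t: "t \<in> {a..b}" "\<And>s. s \<in> {a..b} \<Longrightarrow> g s \<le> g t"
    using continuous_attains_sup[of "{a..b}" g] assms by auto
  have "max_on a b g = g t"
    unfolding max_on_def by (rule cSup_eq_maximum) (use t in auto)
  with t that show thesis by metis
qed

lemma min_on_eq_max_on: "min_on a b g = - max_on a b (\<lambda>t. - g t)" for g :: "real \<Rightarrow> real"
  unfolding min_on_def max_on_def Inf_real_def image_image ..

lemma le_max_on:
  assumes "continuous_on {a..b} g" "t \<in> {a..b}"
  shows "g t \<le> max_on a b g"
  unfolding max_on_def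
  by (rule cSUP_upper[OF assms(2)])
     (intro bounded_imp_bdd_above compact_imp_bounded compact_continuous_image assms(1) compact_Icc)

lemma min_on_le:
  assumes "continuous_on {a..b} g" "t \<in> {a..b}"
  shows "min_on a b g \<le> g t"
  using le_max_on[of a b "\<lambda>t. - g t" t] assms by (simp add: min_on_eq_max_on continuous_on_minus)

lemma min_on_attained:
  assumes "a \<le> b" "continuous_on {a..b} g"
  obtains t where "t \<in> {a..b}" "g t = min_on a b g"
  using max_on_attained[of a b "\<lambda>t. - g t"] assms
  by (metis continuous_on_minus min_on_eq_max_on minus_minus)

lemma abs_le_max_norm:
  assumes "continuous_on {a..b} g" "t \<in> {a..b}"
  shows "\<bar>g t\<bar> \<le> max_norm a b g"
  unfolding max_norm_def using le_max_on[of a b "\<lambda>t. \<bar>g t\<bar>"] assms by (simp add: continuous_on_rabs)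

lemma max_norm_attained:
  assumes "a \<le> b" "continuous_on {a..b} g"
  obtains t where "t \<in> {a..b}" "\<bar>g t\<bar> = max_norm a b g"
  unfolding max_norm_def using max_on_attained[of a b "\<lambda>t. \<bar>g t\<bar>"] assms by (auto simp: continuous_on_rabs)

lemma max_norm_eq_max_on:
  assumes "a \<le> b" "continuous_on {a..b} g" "max_on a b g = - min_on a b g"
  shows "max_norm a b g = max_on a b g"
proof (rule antisym)
  obtain t where "t \<in> {a..b}" "\<bar>g t\<bar> = max_norm a b g" using max_norm_attained assms by blast
  with le_max_on[OF assms(2), of t] min_on_le[OF assms(2), of t] assms(3)
  show "max_norm a b g \<le> max_on a b g" by linarith
  obtain t where "t \<in> {a..b}" "g t = max_on a b g" using max_on_attained assms by blast
  with abs_le_max_norm[OF assms(2), of t] show "max_on a b g \<le> max_norm a b g" by linarith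
qed

lemma max_on_diff_const:
  assumes "a \<le> b" "continuous_on {a..b} g"
  shows "max_on a b (\<lambda>t. g t - c) = max_on a b g - c"
proof (rule antisym)
  have cont: "continuous_on {a..b} (\<lambda>t. g t - c)" using assms by (intro continuous_intros)
  obtain t where "t \<in> {a..b}" "g t - c = max_on a b (\<lambda>t. g t - c)"
    using max_on_attained[OF assms(1) cont] by blast
  then show "max_on a b (\<lambda>t. g t - c) \<le> max_on a b g - c" using le_max_on[OF assms(2), of t] by linarith
  obtain t where "t \<in> {a..b}" "g t = max_on a b g" using max_on_attained assms by blast
  then show "max_on a b g - c \<le> max_on a b (\<lambda>t. g t - c)" using le_max_on[OF cont, of t] by linarith
qed

lemma min_on_diff_const:
  assumes "a \<le> b" "continuous_on {a..b} g"
  shows "min_on a b (\<lambda>t. g t - c) = min_on a b g - c"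
  using max_on_diff_const[of a b "\<lambda>t. - g t" "-c"] assms
  by (simp add: min_on_eq_max_on continuous_on_minus)

section \<open>Recentring the error function\<close>

lemma centre_minus:
  "(\<lambda>t. centre a b f \<sigma> t - f t) =
    (\<lambda>t. (\<lambda>t. \<sigma> t - f t) t - (max_on a b (\<lambda>s. \<sigma> s - f s) + min_on a b (\<lambda>s. \<sigma> s - f s)) / 2)"
  by (auto simp: centre_def)

lemma centre_balanced:
  assumes "a \<le> b" "continuous_on {a..b} (\<lambda>t. \<sigma> t - f t)"
  shows "max_on a b (\<lambda>t. centre a b f \<sigma> t - f t) = - min_on a b (\<lambda>t. centre a b f \<sigma> t - f t)"
  unfolding centre_minus max_on_diff_const[OF assms] min_on_diff_const[OF assms] by (simp add: field_simps)

lemma centre_idem: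
  assumes "max_on a b (\<lambda>t. \<sigma> t - f t) = - min_on a b (\<lambda>t. \<sigma> t - f t)"
  shows "centre a b f \<sigma> = \<sigma>"
  using assms by (auto simp: centre_def)

text \<open>The centred error has norm (max - min) / 2, and neither max nor -min exceeds the norm of
  the original error. Hence recentring never undoes the gain of a descent.\<close>

lemma max_norm_centre_le:
  assumes "a \<le> b" "continuous_on {a..b} (\<lambda>t. \<sigma> t - f t)"
  shows "max_norm a b (\<lambda>t. centre a b f \<sigma> t - f t) \<le> max_norm a b (\<lambda>t. \<sigma> t - f t)"
proof -
  let ?g = "\<lambda>t. \<sigma> t - f t"
  have cont: "continuous_on {a..b} (\<lambda>t. centre a b f \<sigma> t - f t)"
    unfolding centre_minus using assms(2) by (rule continuous_on_diff) simp
  obtain u where u: "u \<in> {a..b}" "?g u = max_on a b ?g" using max_on_attained assms by blast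
  obtain v where v: "v \<in> {a..b}" "?g v = min_on a b ?g" using min_on_attained assms by blast
  have "max_norm a b (\<lambda>t. centre a b f \<sigma> t - f t) = max_on a b (\<lambda>t. centre a b f \<sigma> t - f t)"
    using max_norm_eq_max_on assms cont centre_balanced by blast
  also have "\<dots> = (max_on a b ?g - min_on a b ?g) / 2"
    unfolding centre_minus max_on_diff_const[OF assms] by (simp add: field_simps)
  also have "\<dots> \<le> max_norm a b ?g"
    using abs_le_max_norm[OF assms(2) u(1)] abs_le_max_norm[OF assms(2) v(1)] unfolding u(2) v(2) by (simp add: abs_le_iff)
  finally show ?thesis .
qed

section \<open>Polynomial functions of bounded degree\<close>

lemma poly_funs_continuous_on: "p \<in> poly_funs n \<Longrightarrow> continuous_on S p"
  unfolding poly_funs_def by (auto intro: continuous_on_poly continuous_on_id)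

lemma poly_funs_mono: "m \<le> n \<Longrightarrow> poly_funs m \<subseteq> poly_funs n"
  unfolding poly_funs_def by auto

text \<open>Shaped like a descent step \<open>\<sigma> t - l * \<gamma> t\<close>; sums are the case
  \<open>c = -1\<close>.\<close>

lemma poly_funs_lincomb:
  assumes "p \<in> poly_funs n" "q \<in> poly_funs n"
  shows "(\<lambda>t. p t - c * q t) \<in> poly_funs n"
proof -
  obtain P Q where "p = poly P" "q = poly Q" "degree P \<le> n" "degree Q \<le> n"
    using assms unfolding poly_funs_def by auto
  then show ?thesis
    unfolding poly_funs_def
    by (intro CollectI exI[of _ "P - smult c Q"]) (auto intro: degree_diff_le degree_smult_le order.trans)
qed

lemma poly_funs_const: "(\<lambda>t. c) \<in> poly_funs n"
  unfolding poly_funs_def by (intro CollectI exI[of _ "[:c:]"]) auto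

lemma poly_funs_centre: "\<sigma> \<in> poly_funs n \<Longrightarrow> centre a b f \<sigma> \<in> poly_funs n"
  unfolding centre_def
  using poly_funs_lincomb[OF _ poly_funs_const[of 1 n],
      of \<sigma> "(max_on a b (\<lambda>s. \<sigma> s - f s) + min_on a b (\<lambda>s. \<sigma> s - f s)) / 2"]
  by simp

text \<open>General linear factors cover both the Lagrange basis (\<open>v i = 1\<close>) and the
  descent polynomial (\<open>v i = -1\<close>).\<close>

lemma poly_funs_prod:
  assumes "finite A" "card A \<le> n"
  shows "(\<lambda>t. c * (\<Prod>i\<in>A. u i + v i * t)) \<in> poly_funs n"
proof -
  let ?P = "smult c (\<Prod>i\<in>A. [:u i, v i:])"
  have "degree (\<Prod>i\<in>A. [:u i, v i:]) \<le> (\<Sum>i\<in>A. degree [:u i, v i:])"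
    using degree_prod_sum_le[OF assms(1), of "\<lambda>i. [:u i, v i:]"] by (simp only: o_def)
  also have "\<dots> \<le> (\<Sum>i\<in>A. 1)" by (rule sum_mono) (auto simp: degree_pCons_eq_if)
  finally have "degree (\<Prod>i\<in>A. [:u i, v i:]) \<le> n" using assms(2) by simp
  then have "degree ?P \<le> n" using degree_smult_le order.trans by blast
  moreover have "poly ?P = (\<lambda>t. c * (\<Prod>i\<in>A. u i + v i * t))" 
    by (rule ext) (simp add: poly_prod mult.commute)
  ultimately show ?thesis unfolding poly_funs_def by (intro CollectI exI[of _ ?P]) simp
qed

lemma poly_funs_sum:
  assumes "finite A" "\<And>i. i \<in> A \<Longrightarrow> h i \<in> poly_funs n"
  shows "(\<lambda>t. \<Sum>i\<in>A. h i t) \<in> poly_funs n"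
  using assms
proof (induction A rule: finite_induct)
  case empty
  then show ?case using poly_funs_const[of 0] by simp
next
  case (insert x F)
  then have "(\<lambda>t. h x t - (-1) * (\<Sum>i\<in>F. h i t)) \<in> poly_funs n"
    by (intro poly_funs_lincomb) auto
  then show ?case using insert by simp
qed

lemma poly_funs_descent_poly: "descent_poly k \<epsilon> tm tp \<in> poly_funs k"
  unfolding descent_poly_def
  using poly_funs_prod[of "{..<k}" k \<epsilon> "\<lambda>i. (tp i + tm (i + 1)) / 2" "\<lambda>_. -1"] by simp

lemma poly_funs_initial_line: "a < b \<Longrightarrow> 1 \<le> n \<Longrightarrow> initial_line a b f \<in> poly_funs n"
proof -
  assume "a < b" "1 \<le> n"
  let ?s = "f b / (b - a) - f a / (b - a)" and ?c = "b * f a / (b - a) - a * f b / (b - a)"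
  have "initial_line a b f = poly [:?c, ?s:]"
  proof
    fix t
    show "initial_line a b f t = poly [:?c, ?s:] t"
      using \<open>a < b\<close> by (simp add: initial_line_def divide_simps) (simp add: algebra_simps)
  qed
  with \<open>1 \<le> n\<close> show ?thesis unfolding poly_funs_def by (intro CollectI exI[of _ "[:?c, ?s:]"]) auto
qed

lemma poly_funs_eqI:
  assumes "p \<in> poly_funs n" "q \<in> poly_funs n" "finite X" "n < card X" "\<And>x. x \<in> X \<Longrightarrow> p x = q x"
  shows "p = q"
proof -
  obtain P Q where PQ: "p = poly P" "q = poly Q" "degree P \<le> n" "degree Q \<le> n"
    using assms unfolding poly_funs_def by auto
  have "P = Q"
  proof (rule ccontr)
    assume "P \<noteq> Q"
    then have nz: "P - Q \<noteq> 0" by simp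
    have "card X \<le> card {x. poly (P - Q) x = 0}"
      by (rule card_mono) (use poly_roots_finite[OF nz] assms(5) PQ in auto)
    also have "\<dots> \<le> degree (P - Q)" by (rule card_poly_roots_bound[OF nz])
    also have "\<dots> \<le> n" using PQ by (intro degree_diff_le)
    finally show False using assms(4) by simp
  qed
  with PQ show ?thesis by simp
qed

text \<open>Lagrange interpolation reduces the claim to uniform continuity of finitely many polynomials.\<close>

lemma poly_funs_uniformly_equicontinuous:
  fixes a b B e :: real
  assumes "a < b" "0 < e"
  shows "\<exists>d>0. \<forall>p\<in>poly_funs n. (\<forall>t\<in>{a..b}. \<bar>p t\<bar> \<le> B) \<longrightarrow>
    (\<forall>s\<in>{a..b}. \<forall>t\<in>{a..b}. \<bar>s - t\<bar> < d \<longrightarrow> \<bar>p s - p t\<bar> < e)"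
proof -
  \<comment> \<open>Dividing by \<open>n + 1\<close> rather than \<open>n\<close> keeps the spacing
    positive even for \<open>n = 0\<close>.\<close>
  define x where "x j = a + real j * ((b - a) / real (n + 1))" for j :: nat
  define w where "w j = inverse (\<Prod>i\<in>{..n} - {j}. x j - x i)" for j
  define L where "L j = (\<lambda>t. w j * (\<Prod>i\<in>{..n} - {j}. - x i + 1 * t))" for j
  \<comment> \<open>\<open>H\<close> is the joint variation of the basis polynomials. It vanishes on
    the diagonal, so its uniform continuity makes it small for nearby arguments, for all polynomials
    at once.\<close>
  define H where "H z = (\<Sum>j\<le>n. \<bar>L j (fst z) - L j (snd z)\<bar>)" for z
  have x_inj: "x i = x j \<longleftrightarrow> i = j" for i j using assms(1) unfolding x_def by auto
  have x_in: "x j \<in> {a..b}" if "j \<le> n" for j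
  proof -
    have "real j * ((b - a) / real (n + 1)) \<le> real (n + 1) * ((b - a) / real (n + 1))"
      by (rule mult_right_mono) (use that assms(1) in auto)
    also have "\<dots> = b - a" by simp
    finally show ?thesis unfolding x_def using assms(1) by auto
  qed
  have L_poly: "L j \<in> poly_funs n" if "j \<le> n" for j
    unfolding L_def by (rule poly_funs_prod) (use that in auto)
  have L_node: "L j (x i) = (if i = j then 1 else 0)" if "i \<le> n" for i j
    unfolding L_def w_def using that by (auto simp: x_inj)
  have interp: "p t = (\<Sum>j\<le>n. p (x j) * L j t)" if p: "p \<in> poly_funs n" for p t
  proof -
    have "(\<lambda>t. 0 - (- p (x j)) * L j t) \<in> poly_funs n" if "j \<le> n" for j
      by (rule poly_funs_lincomb[OF poly_funs_const L_poly[OF that]])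
    then have *: "(\<lambda>t. \<Sum>j\<le>n. p (x j) * L j t) \<in> poly_funs n"
      by (intro poly_funs_sum) auto
    have "p = (\<lambda>t. \<Sum>j\<le>n. p (x j) * L j t)"
    proof (rule poly_funs_eqI[OF p *, of "x ` {..n}"])
      show "n < card (x ` {..n})" by (subst card_image) (auto simp: inj_on_def x_inj)
      fix y assume "y \<in> x ` {..n}"
      then obtain i where i: "i \<le> n" "y = x i" by auto
      then have "(\<Sum>j\<le>n. p (x j) * L j y) = (\<Sum>j\<le>n. if i = j then p (x j) else 0)"
        by (intro sum.cong) (simp_all add: L_node)
      then show "p y = (\<Sum>j\<le>n. p (x j) * L j y)" using i by simp
    qed auto
    then show ?thesis by metis
  qed
  have "continuous_on ({a..b} \<times> {a..b}) H"
    unfolding H_def L_def by (intro continuous_intros)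
  then have "uniformly_continuous_on ({a..b} \<times> {a..b}) H"
    by (rule compact_uniformly_continuous) (intro compact_Times compact_Icc)
  \<comment> \<open>\<open>\<bar>B\<bar> + 1\<close> is positive whatever the sign of
    \<open>B\<close>, and it still bounds the values at the nodes.\<close>
  moreover have "0 < e / (\<bar>B\<bar> + 1)" using assms by auto
  ultimately obtain d where d: "d > 0"
    "\<And>z z'. z \<in> {a..b} \<times> {a..b} \<Longrightarrow> z' \<in> {a..b} \<times> {a..b} \<Longrightarrow> dist z' z < d \<Longrightarrow> dist (H z') (H z) < e / (\<bar>B\<bar> + 1)"
    unfolding uniformly_continuous_on_def by metis
  have "\<bar>p s - p t\<bar> < e"
    if p: "p \<in> poly_funs n" "\<forall>t\<in>{a..b}. \<bar>p t\<bar> \<le> B" and st: "s \<in> {a..b}" "t \<in> {a..b}" "\<bar>s - t\<bar> < d" for p s t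
  proof -
    have "H (t, t) = 0" by (simp add: H_def)
    moreover have "dist (H (s, t)) (H (t, t)) < e / (\<bar>B\<bar> + 1)"
      by (rule d(2)) (use st in \<open>auto simp: dist_Pair_Pair dist_real_def\<close>)
    moreover have "0 \<le> H (s, t)" unfolding H_def by (intro sum_nonneg) auto
    ultimately have H: "H (s, t) < e / (\<bar>B\<bar> + 1)" by (simp add: dist_real_def)
    have "p s - p t = (\<Sum>j\<le>n. p (x j) * (L j s - L j t))"
      by (subst (1 2) interp[OF p(1)]) (simp add: sum_subtractf right_diff_distrib)
    also have "\<bar>\<dots>\<bar> \<le> (\<Sum>j\<le>n. (\<bar>B\<bar> + 1) * \<bar>L j s - L j t\<bar>)"
    proof (rule order.trans[OF sum_abs], rule sum_mono)
      fix j assume "j \<in> {..n}"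
      then have "\<bar>p (x j)\<bar> \<le> \<bar>B\<bar> + 1" using p(2) x_in[of j] by fastforce
      then show "\<bar>p (x j) * (L j s - L j t)\<bar> \<le> (\<bar>B\<bar> + 1) * \<bar>L j s - L j t\<bar>"
        unfolding abs_mult by (rule mult_right_mono) simp
    qed
    also have "\<dots> = (\<bar>B\<bar> + 1) * H (s, t)" by (simp add: H_def sum_distrib_left)
    also have "\<dots> < e" using H by (simp add: field_simps)
    finally show ?thesis .
  qed
  with d(1) show ?thesis by blast
qed

text \<open>Each zero found lies strictly between its two neighbouring points, so the
  \<open>n + 1\<close> zeros are distinct. This forces \<open>p\<close> to vanish identically,
  against the strict sign at \<open>x 0\<close>.\<close>

lemma poly_funs_no_long_alternation:
  fixes x :: "nat \<Rightarrow> real"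
  assumes p: "p \<in> poly_funs n"
    and x: "\<And>i. i \<le> n \<Longrightarrow> x i < x (Suc i)"
    and sgn: "\<And>i. i \<le> Suc n \<Longrightarrow> 0 < \<epsilon> * (-1) ^ i * p (x i)"
  shows False
proof -
  have "\<exists>r. x i < r \<and> r < x (Suc i) \<and> p r = 0" if i: "i \<le> n" for i
  proof -
    let ?h = "\<lambda>t. \<epsilon> * (-1) ^ i * p t"
    have 1: "0 < ?h (x i)" using sgn[of i] i by simp
    have 2: "?h (x (Suc i)) < 0" using sgn[of "Suc i"] i by simp
    have "continuous_on {x i..x (Suc i)} ?h"
      by (intro continuous_intros poly_funs_continuous_on[OF p])
    then obtain r where r: "x i \<le> r" "r \<le> x (Suc i)" "?h r = 0"
      using IVT2'[of ?h "x (Suc i)" 0 "x i"] less_imp_le[OF 1] less_imp_le[OF 2] less_imp_le[OF x[OF i]] by blast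
    moreover have "r \<noteq> x i" "r \<noteq> x (Suc i)" using r(3) 1 2 by auto
    moreover have "\<epsilon> \<noteq> 0" using 1 by auto
    ultimately show ?thesis by (intro exI[of _ r]) auto
  qed
  then obtain r where r: "\<And>i. i \<le> n \<Longrightarrow> x i < r i \<and> r i < x (Suc i) \<and> p (r i) = 0" by metis
  have mono: "r i < r j" if "i < j" "j \<le> n" for i j
    using that
  proof (induction j)
    case (Suc j)
    have "r j < r (Suc j)" using r[of j] r[of "Suc j"] Suc.prems by linarith
    with Suc show ?case by (cases "i = j") auto
  qed simp
  have "inj_on r {..n}" by (rule linorder_inj_onI) (use mono in force)+
  then have "p = (\<lambda>_. 0)"
    by (intro poly_funs_eqI[OF p poly_funs_const, of "r ` {..n}"]) (auto simp: card_image r)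
  then show False using sgn[of 0] by simp
qed

section \<open>Consequences of alternance data and uniqueness of its number\<close>

text \<open>Balance makes \<open>max_on\<close> and \<open>max_norm\<close> agree. The norm is the
  form that the descent criterion uses and in which errors of different polynomials are
  compared.\<close>

lemma alternance_dataD:
  assumes "alternance_data a b g \<beta> k \<epsilon> tm tp" "a < b"
  defines "M \<equiv> max_norm a b g"
  shows "continuous_on {a..b} g" "0 < \<beta>" "max_on a b g = - min_on a b g" "0 < M" "1 \<le> k" "\<epsilon> = -1 \<or> \<epsilon> = 1"
    "a \<le> tm 0" "tp k \<le> b" "\<And>i. i \<le> k \<Longrightarrow> tm i \<le> tp i" "\<And>i. i < k \<Longrightarrow> tp i < tm (Suc i)"
    "\<And>i t. i \<le> k \<Longrightarrow> t \<in> {tm i..tp i} \<Longrightarrow> - \<beta> * M < \<epsilon> * (-1) ^ i * g t"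
    "\<And>i. i < k \<Longrightarrow> \<epsilon> * (-1) ^ i * g (tp i) = \<beta> * M"
    "\<And>i. i < k \<Longrightarrow> \<epsilon> * (-1) ^ Suc i * g (tm (Suc i)) = \<beta> * M"
    "\<epsilon> * g (tm 0) \<ge> \<beta> * M" "\<epsilon> * (-1) ^ k * g (tp k) \<ge> \<beta> * M"
    "\<And>t. t \<in> {a..b} - (\<Union>i\<le>k. {tm i..tp i}) \<Longrightarrow> \<bar>g t\<bar> < \<beta> * M"
proof -
  have "max_on a b g = M"
    unfolding M_def by (rule max_norm_eq_max_on[symmetric])
      (use assms in \<open>auto simp: alternance_data_def Let_def\<close>)
  note * = assms(1)[unfolded alternance_data_def Let_def this]
  show "continuous_on {a..b} g" "0 < \<beta>" "0 < M" "1 \<le> k" "\<epsilon> = -1 \<or> \<epsilon> = 1"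
    "a \<le> tm 0" "tp k \<le> b" "\<epsilon> * g (tm 0) \<ge> \<beta> * M" "\<epsilon> * (-1) ^ k * g (tp k) \<ge> \<beta> * M"
    using * by auto
  show "max_on a b g = - min_on a b g" using assms(1) unfolding alternance_data_def Let_def by blast
  show "tm i \<le> tp i" if "i \<le> k" for i using * that by blast
  show "tp i < tm (Suc i)" if "i < k" for i using * that by simp
  show "- \<beta> * M < \<epsilon> * (-1) ^ i * g t" if "i \<le> k" "t \<in> {tm i..tp i}" for i t using * that by blast
  show "\<epsilon> * (-1) ^ i * g (tp i) = \<beta> * M" if "i < k" for i using * that by blast
  show "\<epsilon> * (-1) ^ Suc i * g (tm (Suc i)) = \<beta> * M" if "i < k" for i using * that by (metis Suc_eq_plus1)
  show "\<bar>g t\<bar> < \<beta> * M" if "t \<in> {a..b} - (\<Union>i\<le>k. {tm i..tp i})" for t using * that by blast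
qed

lemma alternance_data_order:
  assumes "alternance_data a b g \<beta> k \<epsilon> tm tp" "a < b" "i < j" "j \<le> k"
  shows "tp i < tm j"
  using assms(3,4)
proof (induction j)
  case (Suc j)
  have "tp j < tm (Suc j)" "tm j \<le> tp j"
    using alternance_dataD(9,10)[OF assms(1,2)] Suc.prems by auto
  with Suc show ?case by (cases "i = j") auto
qed simp

lemma alternance_data_in_Icc:
  assumes "alternance_data a b g \<beta> k \<epsilon> tm tp" "a < b" "i \<le> k" "t \<in> {tm i..tp i}"
  shows "t \<in> {a..b}"
proof -
  note D = alternance_dataD[OF assms(1,2)]
  have "a \<le> tm i" using alternance_data_order[OF assms(1,2), of 0 i] D(7) D(9)[of 0] assms(3) by (cases "i = 0") auto
  moreover have "tp i \<le> b"
    using alternance_data_order[OF assms(1,2), of i k] D(8) D(9)[of k] assms(3) by (cases "i = k") auto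
  ultimately show ?thesis using assms(4) by auto
qed

text \<open>The left end points serve as the alternation both for
  \<open>alternation_length_le\<close> and for the lower bound on the best error.\<close>

lemma alternance_data_alternates:
  assumes "alternance_data a b g \<beta> k \<epsilon> tm tp" "a < b" "i \<le> k"
  shows "\<epsilon> * (-1) ^ i * g (tm i) \<ge> \<beta> * max_norm a b g"
proof (cases i)
  case 0
  then show ?thesis using alternance_dataD(14)[OF assms(1,2)] by simp
next
  case (Suc j)
  then show ?thesis using alternance_dataD(13)[OF assms(1,2), of j] assms(3) by simp
qed

lemma pm1_mult_power_cases:
  fixes \<epsilon> :: real
  assumes "\<epsilon> = -1 \<or> \<epsilon> = 1"
  shows "\<epsilon> * (-1) ^ i = 1 \<or> \<epsilon> * (-1) ^ i = -1"
  using assms by (cases "even i") auto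

text \<open>Consecutive points of an alternation lie in different intervals of the data.\<close>

lemma alternation_length_le:
  assumes data: "alternance_data a b g \<beta> k \<epsilon> tm tp" and "a < b"
    and x_in: "\<And>i. i \<le> j \<Longrightarrow> x i \<in> {a..b}"
    and x_mono: "\<And>i. i < j \<Longrightarrow> x i < x (Suc i)"
    and s: "s = -1 \<or> s = 1"
    and x_alt: "\<And>i. i \<le> j \<Longrightarrow> s * (-1) ^ i * g (x i) \<ge> \<beta> * max_norm a b g"
  shows "j \<le> k"
proof -
  note D = alternance_dataD[OF data \<open>a < b\<close>]
  let ?\<theta> = "\<beta> * max_norm a b g"
  have \<theta>: "0 < ?\<theta>" using D by simp
  have "\<exists>m\<le>k. x i \<in> {tm m..tp m}" if "i \<le> j" for i
  proof (rule ccontr)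
    assume "\<not> ?thesis"
    with x_in[OF that] have "\<bar>g (x i)\<bar> < ?\<theta>" by (intro D(16)) auto
    with x_alt[OF that] pm1_mult_power_cases[OF s, of i] show False by auto
  qed
  then obtain m where m: "\<And>i. i \<le> j \<Longrightarrow> m i \<le> k \<and> x i \<in> {tm (m i)..tp (m i)}" by metis
  have step: "m i < m (Suc i)" if "i < j" for i
  proof -
    have "\<not> m (Suc i) < m i"
      using alternance_data_order[OF data \<open>a < b\<close>, of "m (Suc i)" "m i"] m[of i] m[of "Suc i"] x_mono[OF that] that
      by force
    \<comment> \<open>Inside one interval a value of modulus at least \<open>?\<theta>\<close> must
      carry the sign of that interval, because the opposite level is excluded there. Consecutive
      points of the alternation carry opposite signs.\<close>
    moreover have "m i \<noteq> m (Suc i)"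
    proof
      assume eq: "m i = m (Suc i)"
      let ?e = "\<epsilon> * (-1) ^ m i"
      have "- ?\<theta> < ?e * g (x i)" "- ?\<theta> < ?e * g (x (Suc i))"
        using D(11)[of "m i" "x i"] D(11)[of "m i" "x (Suc i)"] m[of i] m[of "Suc i"] that eq by auto
      moreover have "s * (-1) ^ i * g (x i) \<ge> ?\<theta>" "- (s * (-1) ^ i) * g (x (Suc i)) \<ge> ?\<theta>"
        using x_alt[of i] x_alt[of "Suc i"] that by auto
      ultimately show False
        using pm1_mult_power_cases[OF s, of i] pm1_mult_power_cases[OF D(6), of "m i"] \<theta> by auto
    qed
    ultimately show ?thesis by simp
  qed
  have "i \<le> m i" if "i \<le> j" for i
    using that
  proof (induction i)
    case (Suc i)
    then show ?case using step[of i] by simp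
  qed simp
  with m show ?thesis by (meson order.trans order_refl)
qed

text \<open>The left end points of either data form an alternation for the other, so each number
  bounds the other. This gives the \<open>THE\<close> in \<open>alternance_number\<close> its
  value.\<close>

lemma alternance_data_unique_number:
  assumes "alternance_data a b g \<beta> k \<epsilon> tm tp" "alternance_data a b g \<beta> k' \<epsilon>' tm' tp'" "a < b"
  shows "k = k'"
proof -
  have "k' \<le> k"
    if d: "alternance_data a b g \<beta> k \<epsilon> tm tp" and d': "alternance_data a b g \<beta> k' \<epsilon>' tm' tp'" for k \<epsilon> tm tp k' \<epsilon>' tm' tp'
  proof (rule alternation_length_le[OF d \<open>a < b\<close>, of k' tm' \<epsilon>'])
    note D' = alternance_dataD[OF d' \<open>a < b\<close>]
    show "tm' i \<in> {a..b}" if "i \<le> k'" for i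
      using alternance_data_in_Icc[OF d' \<open>a < b\<close> that] D'(9)[OF that] by simp
    show "tm' i < tm' (Suc i)" if "i < k'" for i
      using D'(9)[of i] D'(10)[OF that] that by simp
  qed (use alternance_dataD(6)[OF d' \<open>a < b\<close>] alternance_data_alternates[OF d' \<open>a < b\<close>] in auto)
  from this[OF assms(1,2)] this[OF assms(2,1)] show ?thesis by simp
qed

section \<open>Existence of alternance data\<close>

text \<open>Greedy construction: \<open>c\<close> is the left end of the first interval; the next interval starts at
  the first point after \<open>c\<close> where the opposite level is reached.\<close>

lemma alternance_chain_exists:
  fixes g :: "real \<Rightarrow> real"
  assumes cont: "continuous_on {a..b} g" and \<theta>: "0 < \<theta>"
    and d: "\<forall>s\<in>{a..b}. \<forall>t\<in>{a..b}. \<bar>s - t\<bar> < d \<longrightarrow> \<bar>g s - g t\<bar> < 2 * \<theta>"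
  shows "c \<in> {a..b} \<Longrightarrow> \<epsilon> = -1 \<or> \<epsilon> = 1 \<Longrightarrow> \<theta> \<le> \<epsilon> * g c \<Longrightarrow> b - c < real m * d \<Longrightarrow>
    \<exists>k tm tp. tm 0 = c \<and> tp k \<le> b \<and> (\<forall>i\<le>k. tm i \<le> tp i) \<and> (\<forall>i<k. tp i < tm (Suc i)) \<and>
      (\<forall>i\<le>k. \<forall>t\<in>{tm i..tp i}. - \<theta> < \<epsilon> * (-1) ^ i * g t) \<and>
      (\<forall>i<k. \<epsilon> * (-1) ^ i * g (tp i) = \<theta> \<and> \<epsilon> * (-1) ^ Suc i * g (tm (Suc i)) = \<theta>) \<and>
      \<theta> \<le> \<epsilon> * (-1) ^ k * g (tp k) \<and>
      (\<forall>t\<in>{c..b} - (\<Union>i\<le>k. {tm i..tp i}). \<bar>g t\<bar> < \<theta>)"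
proof (induction m arbitrary: c \<epsilon>)
  case 0
  then show ?case by simp
next
  case (Suc m)
  let ?h = "\<lambda>t. \<epsilon> * g t"
  have ab: "a \<le> c" "c \<le> b" using Suc.prems by auto
  have conth: "continuous_on {u..v} ?h" if "a \<le> u" "v \<le> b" for u v
    by (intro continuous_intros continuous_on_subset[OF cont]) (use that in auto)
  have compact_level: "compact {t \<in> {u..v}. x \<le> ?h t}" "compact {t \<in> {u..v}. ?h t \<le> x}"
    if "a \<le> u" "v \<le> b" for u v x
    using continuous_closed_preimage[OF conth[OF that], of "{x..}"] continuous_closed_preimage[OF conth[OF that], of "{..x}"]
    by (auto simp: compact_eq_bounded_closed vimage_def Int_def intro: bounded_subset[OF bounded_closed_interval])
  have abs_h: "\<bar>g t\<bar> = \<bar>?h t\<bar>" for t using Suc.prems(2) by auto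
  show ?case
  \<comment> \<open>Either the opposite level is never reached after \<open>c\<close> and a single
    interval suffices, or one interval is put in front of the chain for \<open>- \<epsilon>\<close>
    that starts at the first point \<open>c'\<close> of that level.\<close>
  proof (cases "{t \<in> {c..b}. ?h t \<le> - \<theta>} = {}")
    case True
    obtain q where q: "q \<in> {c..b}" "\<theta> \<le> ?h q" "\<And>t. t \<in> {c..b} \<Longrightarrow> \<theta> \<le> ?h t \<Longrightarrow> t \<le> q"
      using compact_attains_sup[OF compact_level(1)[of c b \<theta>]] ab Suc.prems(3) by fastforce
    have "\<bar>g t\<bar> < \<theta>" if "t \<in> {c..b}" "t \<notin> {c..q}" for t
    proof -
      have "\<not> ?h t \<le> - \<theta>" using True that(1) by blast
      then have "- \<theta> < ?h t" by simp
      moreover have "\<not> t \<le> q" using that by simp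
      then have "\<not> \<theta> \<le> ?h t" using q(3)[OF that(1)] by blast
      ultimately show ?thesis unfolding abs_h by (simp add: abs_less_iff)
    qed
    moreover have "- \<theta> < ?h t" if "t \<in> {c..q}" for t
    proof -
      have "t \<in> {c..b}" using that q(1) by simp
      then have "\<not> ?h t \<le> - \<theta>" using True by blast
      then show ?thesis by simp
    qed
    ultimately show ?thesis
      by - (rule exI[of _ 0], rule exI[of _ "\<lambda>_. c"], rule exI[of _ "\<lambda>_. q"], use q in auto)
  next
    case False
    then obtain c' where c': "c' \<in> {c..b}" "?h c' \<le> - \<theta>" "\<And>t. t \<in> {c..b} \<Longrightarrow> ?h t \<le> - \<theta> \<Longrightarrow> c' \<le> t"
      using compact_attains_inf[OF compact_level(2)[of c b "- \<theta>"]] ab by fastforce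
    obtain q where q: "q \<in> {c..c'}" "\<theta> \<le> ?h q" "\<And>t. t \<in> {c..c'} \<Longrightarrow> \<theta> \<le> ?h t \<Longrightarrow> t \<le> q"
      using compact_attains_sup[OF compact_level(1)[of c c' \<theta>]] ab c'(1) Suc.prems(3) by fastforce
    have "q \<noteq> c'" using q(2) c'(2) \<theta> by auto
    with q(1) have qc': "q < c'" by auto
    \<comment> \<open>The intermediate value theorem provides the exact level between
      \<open>q\<close> and \<open>c'\<close>; since \<open>q\<close> is the last point of its level
      there, the point found is \<open>q\<close>. The same argument with the first point
      \<open>c'\<close> follows.\<close>
    have hq: "?h q = \<theta>"
    proof -
      obtain r where "q \<le> r" "r \<le> c'" "?h r = \<theta>"
        using IVT2'[of ?h c' \<theta> q] q c' \<theta> ab qc' conth[of q c'] by force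
      with q show ?thesis by (metis atLeastAtMost_iff order.antisym order.trans order_refl)
    qed
    have hc': "?h c' = - \<theta>"
    proof -
      obtain r where "q \<le> r" "r \<le> c'" "?h r = - \<theta>"
        using IVT2'[of ?h c' "- \<theta>" q] q c' \<theta> ab qc' conth[of q c'] by force
      with q c' show ?thesis by (metis atLeastAtMost_iff order.antisym order.trans order_refl)
    qed
    \<comment> \<open>Going from \<open>c\<close> to \<open>c'\<close> costs a change of at least 2
      \<theta> in \<open>g\<close>, hence a length of at least \<open>d\<close>. This lets the
      induction on \<open>m\<close> proceed and bounds the number of intervals.\<close>
    have "2 * \<theta> \<le> \<bar>g c - g c'\<bar>" using Suc.prems(2,3) c'(2) by auto
    then have "d \<le> c' - c" using d[rule_format, of c c'] ab c'(1) by fastforce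
    then have n4: "b - c' < real m * d" using Suc.prems(4) by (simp add: algebra_simps)
    have n: "c' \<in> {a..b}" "- \<epsilon> = -1 \<or> - \<epsilon> = 1" "\<theta> \<le> (- \<epsilon>) * g c'"
      using c' ab Suc.prems(2) by auto
    from Suc.IH[OF n n4] obtain k tm tp where IH: "tm 0 = c'" "tp k \<le> b" "\<forall>i\<le>k. tm i \<le> tp i" "\<forall>i<k. tp i < tm (Suc i)"
      "\<forall>i\<le>k. \<forall>t\<in>{tm i..tp i}. - \<theta> < (- \<epsilon>) * (-1) ^ i * g t"
      "\<forall>i<k. (- \<epsilon>) * (-1) ^ i * g (tp i) = \<theta> \<and> (- \<epsilon>) * (-1) ^ Suc i * g (tm (Suc i)) = \<theta>"
      "\<theta> \<le> (- \<epsilon>) * (-1) ^ k * g (tp k)"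
      "\<forall>t\<in>{c'..b} - (\<Union>i\<le>k. {tm i..tp i}). \<bar>g t\<bar> < \<theta>"
      by (elim exE conjE) (rule that)
    define tm' where "tm' = case_nat c tm"
    define tp' where "tp' = case_nat q tp"
    have tm': "tm' 0 = c" "\<And>i. tm' (Suc i) = tm i" and tp': "tp' 0 = q" "\<And>i. tp' (Suc i) = tp i"
      by (simp_all add: tm'_def tp'_def)
    show ?thesis
    proof (rule exI[of _ "Suc k"], rule exI[of _ tm'], rule exI[of _ tp'], intro conjI allI impI ballI)
      show "tm' 0 = c" "tp' (Suc k) \<le> b" "\<theta> \<le> \<epsilon> * (-1) ^ Suc k * g (tp' (Suc k))"
        using IH tm' tp' by auto
      fix i
      show "tm' i \<le> tp' i" if "i \<le> Suc k" using that IH(3) q by (cases i) (auto simp: tm' tp')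
      show "- \<theta> < \<epsilon> * (-1) ^ i * g t" if "i \<le> Suc k" "t \<in> {tm' i..tp' i}" for t
      proof (cases i)
        case 0
        then have "t \<in> {c..q}" using that tm' tp' by simp
        then have "t \<in> {c..b}" "\<not> c' \<le> t" using qc' c'(1) by auto
        then have "\<not> ?h t \<le> - \<theta>" using c'(3) by blast
        then show ?thesis by (simp add: 0)
      next
        case (Suc j)
        then show ?thesis using IH(5) that by (auto simp: tm' tp')
      qed
      assume "i < Suc k"
      then show "tp' i < tm' (Suc i)" using IH(1,4) qc' by (cases i) (auto simp: tm' tp')
      show "\<epsilon> * (-1) ^ i * g (tp' i) = \<theta>" using \<open>i < Suc k\<close> IH(6) hq by (cases i) (auto simp: tm' tp')
      show "\<epsilon> * (-1) ^ Suc i * g (tm' (Suc i)) = \<theta>"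
        using \<open>i < Suc k\<close> IH(1,6) hc' by (cases i) (auto simp: tm' tp')
    next
      fix t assume t: "t \<in> {c..b} - (\<Union>i\<le>Suc k. {tm' i..tp' i})"
      then have t': "t \<notin> {tm' i..tp' i}" if "i \<le> Suc k" for i using that by blast
      show "\<bar>g t\<bar> < \<theta>"
      proof (cases "c' \<le> t")
        case True
        have "t \<notin> {tm i..tp i}" if "i \<le> k" for i
          using t'[of "Suc i"] that tm'(2) tp'(2) by simp
        then have "t \<in> {c'..b} - (\<Union>i\<le>k. {tm i..tp i})" using True t by auto
        with IH(8) show ?thesis by blast
      next
        case False
        have "t \<notin> {c..q}" using t'[of 0] tm'(1) tp'(1) by simp
        with False t have "t \<in> {c..c'}" "t \<in> {c..b}" "\<not> t \<le> q" by auto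
        then have "\<not> \<theta> \<le> ?h t" "\<not> ?h t \<le> - \<theta>" using q(3) c'(3) False by blast+
        then show ?thesis unfolding abs_h by auto
      qed
    qed
  qed
qed

text \<open>The chain starts at the first point where the modulus of \<open>g\<close> reaches
  \<beta> M, so that only smaller values are left before it.\<close>

lemma alternance_data_exists:
  assumes "a < b" and cont: "continuous_on {a..b} g" and bal: "max_on a b g = - min_on a b g"
    and pos: "0 < max_norm a b g" and \<beta>: "0 < \<beta>" "\<beta> < 1"
  shows "\<exists>k \<epsilon> tm tp. alternance_data a b g \<beta> k \<epsilon> tm tp"
proof -
  let ?M = "max_norm a b g" and ?\<theta> = "\<beta> * max_norm a b g"
  have M: "max_on a b g = ?M" "min_on a b g = - ?M"
    using max_norm_eq_max_on[of a b g] assms by auto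
  have \<theta>: "0 < ?\<theta>" "?\<theta> < ?M" using pos \<beta> by auto
  have "uniformly_continuous_on {a..b} g"
    by (intro compact_uniformly_continuous cont) simp
  then obtain d where d: "d > 0" "\<forall>s\<in>{a..b}. \<forall>t\<in>{a..b}. \<bar>s - t\<bar> < d \<longrightarrow> \<bar>g s - g t\<bar> < 2 * ?\<theta>"
    unfolding uniformly_continuous_on_def dist_real_def using \<theta>(1) by (metis mult_pos_pos zero_less_numeral)
  obtain u where u: "u \<in> {a..b}" "g u = ?M" using max_on_attained[OF _ cont] \<open>a < b\<close> M by force
  obtain v where v: "v \<in> {a..b}" "g v = - ?M" using min_on_attained[OF _ cont] \<open>a < b\<close> M by force
  have "compact {t \<in> {a..b}. ?\<theta> \<le> \<bar>g t\<bar>}"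
    using continuous_closed_preimage[of "{a..b}" "\<lambda>t. \<bar>g t\<bar>" "{?\<theta>..}"] cont
    by (auto simp: compact_eq_bounded_closed vimage_def Int_def continuous_on_rabs
        intro: bounded_subset[OF bounded_closed_interval])
  moreover have "u \<in> {t \<in> {a..b}. ?\<theta> \<le> \<bar>g t\<bar>}" using u \<theta>(2) by simp
  then have "{t \<in> {a..b}. ?\<theta> \<le> \<bar>g t\<bar>} \<noteq> {}" by blast
  ultimately obtain c where c: "c \<in> {a..b}" "?\<theta> \<le> \<bar>g c\<bar>" "\<And>t. t \<in> {a..b} \<Longrightarrow> ?\<theta> \<le> \<bar>g t\<bar> \<Longrightarrow> c \<le> t"
    using compact_attains_inf[of "{t \<in> {a..b}. ?\<theta> \<le> \<bar>g t\<bar>}"] by blast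
  define \<epsilon> where "\<epsilon> = (if 0 \<le> g c then 1 else -1 :: real)"
  have \<epsilon>: "\<epsilon> = -1 \<or> \<epsilon> = 1" "?\<theta> \<le> \<epsilon> * g c" using c(2) by (auto simp: \<epsilon>_def)
  obtain m :: nat where m: "b - c < real m * d" using reals_Archimedean3[OF d(1)] by blast
  from alternance_chain_exists[OF cont \<theta>(1) d(2) c(1) \<epsilon> m] obtain k tm tp where ch: "tm 0 = c" "tp k \<le> b" "\<forall>i\<le>k. tm i \<le> tp i" "\<forall>i<k. tp i < tm (Suc i)"
      "\<forall>i\<le>k. \<forall>t\<in>{tm i..tp i}. - ?\<theta> < \<epsilon> * (-1) ^ i * g t"
      "\<forall>i<k. \<epsilon> * (-1) ^ i * g (tp i) = ?\<theta> \<and> \<epsilon> * (-1) ^ Suc i * g (tm (Suc i)) = ?\<theta>"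
      "?\<theta> \<le> \<epsilon> * (-1) ^ k * g (tp k)"
      "\<forall>t\<in>{c..b} - (\<Union>i\<le>k. {tm i..tp i}). \<bar>g t\<bar> < ?\<theta>"
    by (elim exE conjE) (rule that)
  have out: "\<bar>g t\<bar> < ?\<theta>" if "t \<in> {a..b} - (\<Union>i\<le>k. {tm i..tp i})" for t
    using ch(8) c(3)[of t] that by (cases "c \<le> t") auto
  have le_M: "\<epsilon> * (-1) ^ i * g t \<le> ?M" if "t \<in> {a..b}" for i t
    using abs_le_max_norm[OF cont that] pm1_mult_power_cases[OF \<epsilon>(1), of i] by auto
  \<comment> \<open>With a single interval, \<open>\<epsilon> * g t\<close> would stay above
    \<open>- ?\<theta>\<close> on all of [a,b], although \<open>g\<close> attains both M and
    -M.\<close>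
  have "k \<noteq> 0"
  proof
    assume "k = 0"
    have "- ?\<theta> < \<epsilon> * g t" if "t \<in> {a..b}" for t
      using out[of t] ch(5) that \<open>k = 0\<close> \<epsilon>(1) by (cases "t \<in> {tm 0..tp 0}") auto
    from this[OF u(1)] this[OF v(1)] have "- ?\<theta> < \<epsilon> * ?M" "- ?\<theta> < \<epsilon> * - ?M" unfolding u(2) v(2) .
    moreover have "\<epsilon> * ?M = ?M \<or> \<epsilon> * ?M = - ?M" using \<epsilon>(1) by auto
    ultimately show False using \<theta>(2) by linarith
  qed
  have tm_ge: "a \<le> tm i" if "i \<le> k" for i
    using that
  proof (induction i)
    case 0
    then show ?case using c(1) ch(1) by simp
  next
    case (Suc i)
    then show ?case using ch(3)[rule_format, of i] ch(4)[rule_format, of i] by simp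
  qed
  have tp_le: "tp i \<le> b" if "i \<le> k" for i
    using that
  proof (induction rule: inc_induct)
    case base
    then show ?case using ch(2) by simp
  next
    case (step i)
    then show ?case using ch(3)[rule_format, of "Suc i"] ch(4)[rule_format, of i] by simp
  qed
  have "alternance_data a b g \<beta> k \<epsilon> tm tp"
    unfolding alternance_data_def Let_def M(1)
  proof (intro conjI ballI allI impI)
    fix i t assume it: "i \<le> k" "t \<in> {tm i..tp i}"
    show "- \<beta> * ?M < \<epsilon> * (-1) ^ i * g t" using ch(5) it by auto
    show "\<epsilon> * (-1) ^ i * g t \<le> ?M" by (rule le_M) (use it tm_ge[of i] tp_le[of i] in auto)
  next
    fix i assume "i < k"
    with ch(4,6) show "tp i < tm (i + 1)" "\<epsilon> * (-1) ^ i * g (tp i) = \<beta> * ?M"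
      "\<epsilon> * (-1) ^ (i + 1) * g (tm (i + 1)) = \<beta> * ?M" by simp_all
  next
    fix t assume "t \<in> {a..b} - (\<Union>i\<le>k. {tm i..tp i})"
    then show "\<bar>g t\<bar> < \<beta> * ?M" by (rule out)
  next
    show "tm i \<le> tp i" if "i \<le> k" for i using ch(3) that by blast
  qed (use tm_ge[of 0] assms \<epsilon> ch(1,2,7) M \<open>k \<noteq> 0\<close> in simp_all)
  then show ?thesis by blast
qed

section \<open>The descent polynomial and admissible step lengths\<close>

text \<open>The node is the midpoint of a gap and the interval lies entirely on one side of that
  gap, so half the gap separates them. The estimate yields both the sign of the descent polynomial
  and the lower bound on its modulus.\<close>

lemma descent_poly_nodes_apart:
  assumes data: "alternance_data a b g \<beta> k \<epsilon> tm tp" and "a < b"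
    and "i \<le> k" "t \<in> {tm i..tp i}" "j < k"
  shows "(tm (Suc j) - tp j) / 2 \<le> (if j < i then -1 else 1) * ((tp j + tm (Suc j)) / 2 - t)"
proof (cases "j < i")
  case True
  have "tm (Suc j) \<le> tm i"
    using True alternance_data_order[OF data \<open>a < b\<close>, of "Suc j" i] alternance_dataD(9)[OF data \<open>a < b\<close>, of "Suc j"] assms(3)
    by (cases "Suc j = i") auto
  then show ?thesis using True assms(4) by (auto simp: field_simps)
next
  case False
  have "tp i \<le> tp j"
    using False alternance_data_order[OF data \<open>a < b\<close>, of i j] alternance_dataD(9)[OF data \<open>a < b\<close>, of j] assms(5)
    by (cases "j = i") auto
  then show ?thesis using False assms(4) by (auto simp: field_simps)
qed

text \<open>Exactly the \<open>i\<close> nodes to the left of interval \<open>i\<close> contribute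
  negative factors. On the intervals the descent polynomial thus has the sign of the large errors,
  and subtracting a small multiple of it lowers them.\<close>

lemma descent_poly_sign:
  assumes data: "alternance_data a b g \<beta> k \<epsilon> tm tp" and "a < b"
    and "i \<le> k" "t \<in> {tm i..tp i}"
  shows "\<epsilon> * (-1) ^ i * descent_poly k \<epsilon> tm tp t = \<bar>descent_poly k \<epsilon> tm tp t\<bar>"
    and "descent_poly k \<epsilon> tm tp t \<noteq> 0"
proof -
  note D = alternance_dataD[OF data \<open>a < b\<close>]
  let ?u = "\<lambda>j. (tp j + tm (Suc j)) / 2 - t"
  let ?s = "\<lambda>j. if j < i then -1 else 1 :: real"
  have pos: "0 < ?s j * ?u j" if "j < k" for j
    by (rule less_le_trans[OF _ descent_poly_nodes_apart[OF assms that]]) (use D(10)[OF that] in simp)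
  have "(\<Prod>j<k. ?s j) = (\<Prod>j\<in>{..<k} \<inter> {j. j < i}. -1)"
    by (simp add: prod.If_cases)
  also have "{..<k} \<inter> {j. j < i} = {..<i}" using assms(3) by auto
  finally have s: "(\<Prod>j<k. ?s j) = (-1) ^ i" by simp
  have "\<epsilon> * (-1) ^ i * descent_poly k \<epsilon> tm tp t = (\<epsilon> * \<epsilon>) * ((\<Prod>j<k. ?s j) * (\<Prod>j<k. ?u j))"
    unfolding s descent_poly_def by (simp add: mult_ac)
  also have "\<dots> = (\<Prod>j<k. ?s j * ?u j)" using D(6) by (auto simp: prod.distrib)
  also have "\<dots> > 0" using pos by (intro prod_pos) auto
  finally have *: "0 < \<epsilon> * (-1) ^ i * descent_poly k \<epsilon> tm tp t" .
  then show "\<epsilon> * (-1) ^ i * descent_poly k \<epsilon> tm tp t = \<bar>descent_poly k \<epsilon> tm tp t\<bar>"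
    using pm1_mult_power_cases[OF D(6), of i] by auto
  show "descent_poly k \<epsilon> tm tp t \<noteq> 0" using * by auto
qed

text \<open>The union of the intervals is compact, nonempty and free of zeros, so the infimum in
  \<open>descent_ratio\<close> is an attained, positive minimum.\<close>

lemma descent_poly_extrema:
  assumes data: "alternance_data a b g \<beta> k \<epsilon> tm tp" and "a < b"
  defines "\<gamma> \<equiv> descent_poly k \<epsilon> tm tp"
  defines "m \<equiv> INF t\<in>(\<Union>i\<le>k. {tm i..tp i}). \<bar>\<gamma> t\<bar>"
  shows "0 < m" "m \<le> max_norm a b \<gamma>" "\<exists>t\<in>(\<Union>i\<le>k. {tm i..tp i}). \<bar>\<gamma> t\<bar> = m"
    "\<And>i t. i \<le> k \<Longrightarrow> t \<in> {tm i..tp i} \<Longrightarrow> m \<le> \<bar>\<gamma> t\<bar>"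
    "descent_ratio a b k tm tp \<gamma> = m / max_norm a b \<gamma>"
proof -
  note D = alternance_dataD[OF data \<open>a < b\<close>]
  let ?U = "\<Union>i\<le>k. {tm i..tp i}"
  have cont: "continuous_on S \<gamma>" for S
    unfolding \<gamma>_def using poly_funs_continuous_on poly_funs_descent_poly by blast
  have "compact ?U" by (intro compact_UN) auto
  moreover have "tm 0 \<in> ?U" using D(9)[of 0] by (intro UN_I[of 0]) auto
  ultimately obtain t where t: "t \<in> ?U" "\<And>s. s \<in> ?U \<Longrightarrow> \<bar>\<gamma> t\<bar> \<le> \<bar>\<gamma> s\<bar>"
    using continuous_attains_inf[of ?U "\<lambda>t. \<bar>\<gamma> t\<bar>"] continuous_on_rabs[OF cont] by blast
  have m: "m = \<bar>\<gamma> t\<bar>" unfolding m_def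
    by (rule cInf_eq_minimum[OF imageI[OF t(1)]]) (use t(2) in blast)
  show "0 < m" using t(1) descent_poly_sign(2)[OF data \<open>a < b\<close>] unfolding m \<gamma>_def by auto
  show "m \<le> max_norm a b \<gamma>"
    unfolding m by (rule abs_le_max_norm[OF cont]) (use t(1) alternance_data_in_Icc[OF data \<open>a < b\<close>] in blast)
  show "\<exists>t\<in>?U. \<bar>\<gamma> t\<bar> = m" using t(1) m by blast
  show "m \<le> \<bar>\<gamma> s\<bar>" if "i \<le> k" "s \<in> {tm i..tp i}" for i s
    unfolding m by (rule t(2)) (use that in blast)
  show "descent_ratio a b k tm tp \<gamma> = m / max_norm a b \<gamma>"
    unfolding descent_ratio_def m_def max_norm_def ..
qed

text \<open>The step \<open>l0\<close> balances the bound at points of large \<open>\<bar>g\<bar>\<close> against the bound elsewhere, where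
  it is strict by compactness; a slightly longer step makes the former strict, too.\<close>

lemma descent_step_exists:
  assumes data: "alternance_data a b g \<beta> k \<epsilon> tm tp" and "a < b" and "\<beta> < 1"
  defines "\<gamma> \<equiv> descent_poly k \<epsilon> tm tp"
  defines "\<rho> \<equiv> descent_ratio a b k tm tp \<gamma>"
  shows "\<exists>l>0. max_norm a b (\<lambda>t. g t - l * \<gamma> t) < (1 + \<beta> * \<rho>) / (1 + \<rho>) * max_norm a b g"
proof -
  note D = alternance_dataD[OF data \<open>a < b\<close>]
  let ?M = "max_norm a b g" and ?\<mu> = "max_norm a b \<gamma>"
  define m where "m = (INF t\<in>(\<Union>i\<le>k. {tm i..tp i}). \<bar>\<gamma> t\<bar>)"
  note ext = descent_poly_extrema[OF data \<open>a < b\<close>, folded \<gamma>_def, folded m_def]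
  have m: "0 < m" "0 < ?\<mu>" using ext(1,2) by auto
  \<comment> \<open>The solution of \<open>\<beta> * ?M + l0 * ?\<mu> = ?M - l0 * m\<close>; the
    common value \<open>R\<close> turns out to be the acceptance threshold.\<close>
  define l0 where "l0 = (1 - \<beta>) * ?M / (m + ?\<mu>)"
  define R where "R = \<beta> * ?M + l0 * ?\<mu>"
  have l0: "0 < l0" unfolding l0_def using m D(4) \<open>\<beta> < 1\<close> by simp
  have "l0 * (m + ?\<mu>) = (1 - \<beta>) * ?M" unfolding l0_def using m by simp
  then have R: "R = ?M - l0 * m" unfolding R_def by (simp add: algebra_simps)
  have "R * (m + ?\<mu>) = ?M * (m + ?\<mu>) - (1 - \<beta>) * ?M * m"
    unfolding R l0_def using m by (simp add: field_simps)
  also have "\<dots> = (?\<mu> + \<beta> * m) * ?M" by (simp add: algebra_simps)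
  finally have "R = (?\<mu> + \<beta> * m) / (?\<mu> + m) * ?M" using m by (simp add: field_simps)
  also have "(?\<mu> + \<beta> * m) / (?\<mu> + m) = (1 + \<beta> * \<rho>) / (1 + \<rho>)"
  proof -
    have "1 + \<beta> * \<rho> = (?\<mu> + \<beta> * m) / ?\<mu>" "1 + \<rho> = (?\<mu> + m) / ?\<mu>"
      unfolding \<rho>_def ext(5) using m by (simp_all add: add_divide_distrib)
    then show ?thesis using m by simp
  qed
  finally have bound: "(1 + \<beta> * \<rho>) / (1 + \<rho>) * ?M = R" ..
  have \<theta>: "0 < \<beta> * ?M" "\<beta> * ?M < ?M" using D(2,4) \<open>\<beta> < 1\<close> by auto
  have cont\<gamma>: "continuous_on {a..b} \<gamma>"
    unfolding \<gamma>_def using poly_funs_continuous_on poly_funs_descent_poly by blast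
  have abs\<gamma>: "\<bar>\<gamma> t\<bar> \<le> ?\<mu>" if "t \<in> {a..b}" for t by (rule abs_le_max_norm[OF cont\<gamma> that])
  have upper: "\<exists>s. (s = -1 \<or> s = 1) \<and> - (\<beta> * ?M) < s * g t \<and> s * \<gamma> t = \<bar>\<gamma> t\<bar> \<and> m \<le> \<bar>\<gamma> t\<bar>"
    if t: "t \<in> {a..b}" "\<beta> * ?M \<le> \<bar>g t\<bar>" for t
  proof -
    have "t \<in> (\<Union>i\<le>k. {tm i..tp i})" using D(16)[of t] t by (meson DiffI not_less)
    then obtain i where i: "i \<le> k" "t \<in> {tm i..tp i}" by blast
    show ?thesis
      using D(11)[OF i] descent_poly_sign(1)[OF data \<open>a < b\<close> i] ext(4)[OF i] pm1_mult_power_cases[OF D(6), of i]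
      unfolding \<gamma>_def by (intro exI[of _ "\<epsilon> * (-1) ^ i"]) auto
  qed
  let ?C = "{t \<in> {a..b}. \<bar>g t\<bar> \<le> \<beta> * ?M}"
  have strict: "\<bar>g t - l0 * \<gamma> t\<bar> < R" if t: "t \<in> ?C" for t
  proof -
    have b: "l0 * \<bar>\<gamma> t\<bar> \<le> l0 * ?\<mu>" using abs\<gamma>[of t] t l0 by (intro mult_left_mono) auto
    show ?thesis
    proof (cases "\<bar>g t\<bar> < \<beta> * ?M")
      case True
      have "\<bar>g t - l0 * \<gamma> t\<bar> \<le> \<bar>g t\<bar> + l0 * \<bar>\<gamma> t\<bar>"
        using abs_triangle_ineq4[of "g t" "l0 * \<gamma> t"] l0 by (simp add: abs_mult)
      with True b show ?thesis unfolding R_def by linarith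
    next
      \<comment> \<open>At modulus exactly \<open>\<beta> * ?M\<close> the triangle inequality would
        only give a weak bound. Such a point lies in an interval, where the lower bound on the
        signed error is strict and the step moves it downwards by a positive amount.\<close>
      case False
      with t obtain s where s: "s = -1 \<or> s = 1" "- (\<beta> * ?M) < s * g t" "s * \<gamma> t = \<bar>\<gamma> t\<bar>" "m \<le> \<bar>\<gamma> t\<bar>"
        using upper[of t] by auto
      have "0 < l0 * \<bar>\<gamma> t\<bar>" using l0 s(4) m by simp
      moreover have "s * g t \<le> \<beta> * ?M" using s(1) t by auto
      moreover have "0 < l0 * ?\<mu>" using l0 m by simp
      ultimately have "\<bar>s * g t - l0 * \<bar>\<gamma> t\<bar>\<bar> < R" using s(2) b \<theta> unfolding R_def by linarith
      moreover have "s * g t - l0 * \<bar>\<gamma> t\<bar> = s * (g t - l0 * \<gamma> t)"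
        unfolding s(3)[symmetric] by (simp add: algebra_simps)
      ultimately show ?thesis using s(1) by (auto simp: abs_minus_commute)
    qed
  qed
  \<comment> \<open>Compactness of \<open>?C\<close> turns the pointwise strict bound into a uniform
    margin \<open>d\<close>, part of which the longer step may use up.\<close>
  have "\<exists>d>0. \<forall>t\<in>?C. \<bar>g t - l0 * \<gamma> t\<bar> \<le> R - d"
  proof (cases "?C = {}")
    case False
    have "compact ?C"
      using continuous_closed_preimage[of "{a..b}" "\<lambda>t. \<bar>g t\<bar>" "{..\<beta> * ?M}"] D(1)
      by (auto simp: compact_eq_bounded_closed vimage_def Int_def continuous_on_rabs
          intro: bounded_subset[OF bounded_closed_interval])
    moreover have "continuous_on ?C (\<lambda>t. \<bar>g t - l0 * \<gamma> t\<bar>)"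
      by (rule continuous_on_subset[of "{a..b}"]) (auto intro!: continuous_intros D(1) cont\<gamma>)
    ultimately obtain t where "t \<in> ?C" "\<And>s. s \<in> ?C \<Longrightarrow> \<bar>g s - l0 * \<gamma> s\<bar> \<le> \<bar>g t - l0 * \<gamma> t\<bar>"
      using continuous_attains_sup[of ?C "\<lambda>t. \<bar>g t - l0 * \<gamma> t\<bar>"] False by blast
    then show ?thesis using strict[of t] by (intro exI[of _ "R - \<bar>g t - l0 * \<gamma> t\<bar>"]) auto
  qed (auto intro: exI[of _ 1])
  then obtain d where d: "0 < d" "\<And>t. t \<in> ?C \<Longrightarrow> \<bar>g t - l0 * \<gamma> t\<bar> \<le> R - d" by blast
  \<comment> \<open>The bound \<open>d / 2\<close> preserves part of the margin on
    \<open>?C\<close>; the bound \<open>\<beta> * ?M\<close> prevents points of large error from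
    overshooting below \<open>- R\<close>.\<close>
  define e where "e = min (d / 2) (\<beta> * ?M) / ?\<mu>"
  have "0 < e" using d(1) \<theta>(1) m by (simp add: e_def)
  have "e * ?\<mu> = min (d / 2) (\<beta> * ?M)" using m by (simp add: e_def)
  then have e: "0 < e" "e * ?\<mu> \<le> d / 2" "e * ?\<mu> \<le> \<beta> * ?M" using \<open>0 < e\<close> by auto
  have "continuous_on {a..b} (\<lambda>t. g t - (l0 + e) * \<gamma> t)"
    by (intro continuous_intros D(1) cont\<gamma>)
  then obtain t where t: "t \<in> {a..b}" "\<bar>g t - (l0 + e) * \<gamma> t\<bar> = max_norm a b (\<lambda>t. g t - (l0 + e) * \<gamma> t)"
    using max_norm_attained[of a b "\<lambda>t. g t - (l0 + e) * \<gamma> t"] \<open>a < b\<close> by auto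
  have e\<gamma>: "e * \<bar>\<gamma> t\<bar> \<le> e * ?\<mu>" using abs\<gamma>[OF t(1)] e by (intro mult_left_mono) auto
  have l\<gamma>: "l0 * \<bar>\<gamma> t\<bar> \<le> l0 * ?\<mu>" using abs\<gamma>[OF t(1)] l0 by (intro mult_left_mono) auto
  have "\<bar>g t - (l0 + e) * \<gamma> t\<bar> < R"
  proof (cases "t \<in> ?C")
    case True
    have "\<bar>g t - (l0 + e) * \<gamma> t\<bar> \<le> \<bar>g t - l0 * \<gamma> t\<bar> + e * \<bar>\<gamma> t\<bar>"
      using abs_triangle_ineq4[of "g t - l0 * \<gamma> t" "e * \<gamma> t"] e by (simp add: abs_mult algebra_simps)
    with d(2)[OF True] d(1) e\<gamma> e(2) show ?thesis by linarith
  next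
    \<comment> \<open>Here the length \<open>l0\<close> alone gives at most
      \<open>?M - l0 * m = R\<close>; the additional \<open>e * \<bar>\<gamma> t\<bar>\<close> makes
      the inequality strict.\<close>
    case False
    with t(1) have big: "\<beta> * ?M < \<bar>g t\<bar>" by auto
    with upper[OF t(1)] obtain s where s: "s = -1 \<or> s = 1" "- (\<beta> * ?M) < s * g t" "s * \<gamma> t = \<bar>\<gamma> t\<bar>" "m \<le> \<bar>\<gamma> t\<bar>"
      by auto
    have "\<beta> * ?M < s * g t" using s(1,2) big by auto
    moreover have "s * g t \<le> ?M" using s(1) abs_le_max_norm[OF D(1) t(1)] by auto
    moreover have "l0 * m \<le> l0 * \<bar>\<gamma> t\<bar>" using s(4) l0 by simp
    moreover have "0 < e * \<bar>\<gamma> t\<bar>" using s(4) m e by simp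
    ultimately have "s * g t - l0 * \<bar>\<gamma> t\<bar> - e * \<bar>\<gamma> t\<bar> < R" "- R < s * g t - l0 * \<bar>\<gamma> t\<bar> - e * \<bar>\<gamma> t\<bar>"
      using R l\<gamma> e\<gamma> e(3) \<theta> unfolding R_def by linarith+
    moreover have "s * g t - l0 * \<bar>\<gamma> t\<bar> - e * \<bar>\<gamma> t\<bar> = s * (g t - (l0 + e) * \<gamma> t)"
      unfolding s(3)[symmetric] by (simp add: algebra_simps)
    ultimately show ?thesis using s(1) by auto
  qed
  with t(2) bound l0 e(1) show ?thesis by (intro exI[of _ "l0 + e"]) auto
qed

section \<open>Uniform contraction by descent steps\<close>

text \<open>Each of the \<open>k\<close> factors has modulus at least d/2 on the intervals and at
  most b - a on [a,b].\<close>

lemma descent_ratio_ge: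
  assumes data: "alternance_data a b g \<beta> k \<epsilon> tm tp" and "a < b" and "0 < d"
    and gap: "\<And>j. j < k \<Longrightarrow> d \<le> tm (Suc j) - tp j"
  shows "(d / (2 * (b - a))) ^ k \<le> descent_ratio a b k tm tp (descent_poly k \<epsilon> tm tp)"
proof -
  note D = alternance_dataD[OF data \<open>a < b\<close>]
  let ?\<gamma> = "descent_poly k \<epsilon> tm tp"
  let ?u = "\<lambda>j t. (tp j + tm (Suc j)) / 2 - t"
  note ext = descent_poly_extrema[OF data \<open>a < b\<close>]
  have abs\<gamma>: "\<bar>?\<gamma> t\<bar> = (\<Prod>j<k. \<bar>?u j t\<bar>)" for t
    using D(6) by (auto simp: descent_poly_def abs_mult abs_prod)
  obtain i t where t: "i \<le> k" "t \<in> {tm i..tp i}"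
    "\<bar>?\<gamma> t\<bar> = (INF t\<in>(\<Union>i\<le>k. {tm i..tp i}). \<bar>?\<gamma> t\<bar>)" using ext(3) by blast
  have "(\<Prod>j<k. d / 2) \<le> (\<Prod>j<k. \<bar>?u j t\<bar>)"
  proof (rule prod_mono)
    fix j assume "j \<in> {..<k}"
    then have "d / 2 \<le> (tm (Suc j) - tp j) / 2" using gap[of j] by simp
    also have "\<dots> \<le> (if j < i then -1 else 1) * ?u j t"
      using descent_poly_nodes_apart[OF data \<open>a < b\<close> t(1,2)] \<open>j \<in> {..<k}\<close> by simp
    also have "\<dots> \<le> \<bar>?u j t\<bar>" by (cases "j < i") (simp_all only: if_True if_False mult_1_left mult_minus1 abs_ge_self abs_ge_minus_self)
    finally have "d / 2 \<le> \<bar>?u j t\<bar>" .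
    with \<open>0 < d\<close> show "0 \<le> d / 2 \<and> d / 2 \<le> \<bar>?u j t\<bar>" by simp
  qed
  then have lower: "(d / 2) ^ k \<le> \<bar>?\<gamma> t\<bar>" unfolding abs\<gamma> by simp
  have "continuous_on {a..b} ?\<gamma>" using poly_funs_continuous_on poly_funs_descent_poly by blast
  then obtain s where s: "s \<in> {a..b}" "\<bar>?\<gamma> s\<bar> = max_norm a b ?\<gamma>"
    using max_norm_attained[of a b ?\<gamma>] \<open>a < b\<close> by auto
  have "(\<Prod>j<k. \<bar>?u j s\<bar>) \<le> (\<Prod>j<k. b - a)"
  proof (rule prod_mono)
    fix j assume "j \<in> {..<k}"
    then have "tp j \<in> {a..b}" "tm (Suc j) \<in> {a..b}"
      using alternance_data_in_Icc[OF data \<open>a < b\<close>, of j "tp j"] D(9)[of j]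
        alternance_data_in_Icc[OF data \<open>a < b\<close>, of "Suc j" "tm (Suc j)"] D(9)[of "Suc j"] by auto
    with s(1) show "0 \<le> \<bar>?u j s\<bar> \<and> \<bar>?u j s\<bar> \<le> b - a" by (auto simp: abs_le_iff field_simps)
  qed
  then have upper: "max_norm a b ?\<gamma> \<le> (b - a) ^ k" using abs\<gamma>[of s] s(2) by simp
  have "(d / (2 * (b - a))) ^ k = (d / 2) ^ k / (b - a) ^ k" by (simp only: power_divide power_mult_distrib divide_divide_eq_left)
  also have "\<dots> \<le> \<bar>?\<gamma> t\<bar> / max_norm a b ?\<gamma>"
    by (rule frac_le) (use lower upper ext(1,2) in auto)
  finally show ?thesis unfolding ext(5) t(3) .
qed

text \<open>The factor equals 1 - (1 - \<beta>) \<rho> / (1 + \<rho>), which grows with \<beta> and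
  falls with \<rho>. The case \<open>r = 0\<close> gives the plain bound 1.\<close>

lemma contraction_factor_le:
  fixes r \<rho> \<beta> \<beta>' :: real
  assumes "0 \<le> r" "r \<le> \<rho>" "\<beta> \<le> \<beta>'" "\<beta>' < 1"
  shows "(1 + \<beta> * \<rho>) / (1 + \<rho>) \<le> 1 - (1 - \<beta>') * (r / (1 + r))"
proof -
  have "(1 + \<beta> * \<rho>) / (1 + \<rho>) = 1 - (1 - \<beta>) * (\<rho> / (1 + \<rho>))"
    using assms by (simp add: field_simps)
  moreover have "r / (1 + r) \<le> \<rho> / (1 + \<rho>)" using assms by (simp add: divide_simps) (simp add: algebra_simps)
  then have "(1 - \<beta>') * (r / (1 + r)) \<le> (1 - \<beta>) * (\<rho> / (1 + \<rho>))"
    using assms by (intro mult_mono) auto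
  ultimately show ?thesis by simp
qed

text \<open>Equicontinuity bounds the gaps between consecutive intervals from below, hence also
  \<open>descent_ratio\<close>.\<close>

lemma uniform_contraction:
  fixes a b B E \<beta>lo \<beta>hi :: real
  assumes "a < b" and cont: "continuous_on {a..b} f" and "0 < E" "0 < \<beta>lo" "0 < \<beta>hi" "\<beta>hi < 1"
  shows "\<exists>q. 0 < q \<and> q < 1 \<and> (\<forall>\<sigma>\<in>poly_funs n. \<forall>\<beta>\<in>{\<beta>lo..\<beta>hi}. \<forall>k \<epsilon> tm tp.
    E \<le> max_norm a b (\<lambda>t. \<sigma> t - f t) \<longrightarrow> max_norm a b (\<lambda>t. \<sigma> t - f t) \<le> B \<longrightarrow>
    alternance_data a b (\<lambda>t. \<sigma> t - f t) \<beta> k \<epsilon> tm tp \<longrightarrow> k \<le> n \<longrightarrow>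
    (let \<rho> = descent_ratio a b k tm tp (descent_poly k \<epsilon> tm tp) in (1 + \<beta> * \<rho>) / (1 + \<rho>) \<le> q))"
proof -
  have e: "0 < \<beta>lo * E" using assms by simp
  obtain d1 where d1: "0 < d1" "\<And>p s t. p \<in> poly_funs n \<Longrightarrow> (\<And>t. t\<in>{a..b} \<Longrightarrow> \<bar>p t\<bar> \<le> B + max_norm a b f) \<Longrightarrow>
      s \<in> {a..b} \<Longrightarrow> t \<in> {a..b} \<Longrightarrow> \<bar>s - t\<bar> < d1 \<Longrightarrow> \<bar>p s - p t\<bar> < \<beta>lo * E"
    using poly_funs_uniformly_equicontinuous[OF \<open>a < b\<close> e, of n "B + max_norm a b f"] by blast
  have "uniformly_continuous_on {a..b} f" by (intro compact_uniformly_continuous cont) simp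
  then obtain d2 where d2: "0 < d2" "\<And>s t. s \<in> {a..b} \<Longrightarrow> t \<in> {a..b} \<Longrightarrow> \<bar>s - t\<bar> < d2 \<Longrightarrow> \<bar>f s - f t\<bar> < \<beta>lo * E"
    unfolding uniformly_continuous_on_def dist_real_def using e by metis
  \<comment> \<open>Including \<open>b - a\<close> makes the base of the power in \<open>r\<close>
    at most 1, so that the exponent \<open>n\<close> covers every \<open>k \<le> n\<close>.\<close>
  define d where "d = min (b - a) (min d1 d2)"
  define r where "r = (d / (2 * (b - a))) ^ n"
  define q where "q = 1 - (1 - \<beta>hi) * (r / (1 + r))"
  have d: "0 < d" "d \<le> b - a" "d \<le> d1" "d \<le> d2" using d1(1) d2(1) \<open>a < b\<close> by (auto simp: d_def)
  have base: "0 < d / (2 * (b - a))" "d / (2 * (b - a)) \<le> 1" using d(1,2) \<open>a < b\<close> by auto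
  have r: "0 < r" using base by (simp add: r_def)
  then have x: "0 < r / (1 + r)" "r / (1 + r) < 1" by auto
  have "0 < (1 - \<beta>hi) * (r / (1 + r))" by (rule mult_pos_pos[OF _ x(1)]) (use assms in simp)
  then have "q < 1" by (simp add: q_def)
  moreover have "(1 - \<beta>hi) * (r / (1 + r)) < 1 * 1" using x assms by (intro mult_strict_mono) auto
  then have "0 < q" by (simp add: q_def)
  moreover have "(1 + \<beta> * \<rho>) / (1 + \<rho>) \<le> q"
    if \<sigma>: "\<sigma> \<in> poly_funs n" and \<beta>: "\<beta> \<in> {\<beta>lo..\<beta>hi}" and E: "E \<le> max_norm a b (\<lambda>t. \<sigma> t - f t)"
      and B: "max_norm a b (\<lambda>t. \<sigma> t - f t) \<le> B"
      and data: "alternance_data a b (\<lambda>t. \<sigma> t - f t) \<beta> k \<epsilon> tm tp" and "k \<le> n"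
      and \<rho>: "\<rho> = descent_ratio a b k tm tp (descent_poly k \<epsilon> tm tp)" for \<sigma> \<beta> k \<epsilon> tm tp \<rho>
  proof -
    note D = alternance_dataD[OF data \<open>a < b\<close>]
    have \<sigma>_le: "\<bar>\<sigma> t\<bar> \<le> B + max_norm a b f" if "t \<in> {a..b}" for t
      using abs_le_max_norm[OF D(1) that] abs_le_max_norm[OF cont that] B by linarith
    have gap: "d \<le> tm (Suc j) - tp j" if "j < k" for j
    proof (rule ccontr)
      assume "\<not> ?thesis"
      then have close: "\<bar>tm (Suc j) - tp j\<bar> < d" using D(10)[OF that] by simp
      have pts: "tp j \<in> {a..b}" "tm (Suc j) \<in> {a..b}"
        using alternance_data_in_Icc[OF data \<open>a < b\<close>, of j "tp j"] D(9)[of j]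
          alternance_data_in_Icc[OF data \<open>a < b\<close>, of "Suc j" "tm (Suc j)"] D(9)[of "Suc j"] that by auto
      let ?g = "\<lambda>t. \<sigma> t - f t" and ?s = "\<epsilon> * (-1) ^ j"
      \<comment> \<open>In a gap shorter than \<open>d\<close>, the polynomial and \<open>f\<close>
        each change by less than \<open>\<beta>lo * E\<close>. Together this is too little for the
        change of twice \<beta> times the norm that the data require.\<close>
      have "\<bar>?g (tm (Suc j)) - ?g (tp j)\<bar> < 2 * (\<beta>lo * E)"
        using d1(2)[OF \<sigma> \<sigma>_le pts(2,1)] d2(2)[OF pts(2,1)] close d(3,4) by linarith
      also have "\<dots> \<le> 2 * (\<beta> * max_norm a b ?g)"
        using \<beta> E assms by (intro mult_left_mono mult_mono) auto
      also have "\<dots> = \<bar>?s * ?g (tp j) - ?s * ?g (tm (Suc j))\<bar>"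
      proof -
        have "?s * ?g (tm (Suc j)) = - (\<beta> * max_norm a b ?g)" using D(13)[OF that] by simp
        then show ?thesis unfolding D(12)[OF that] using mult_pos_pos[OF D(2,4)] by simp
      qed
      also have "\<dots> = \<bar>?g (tm (Suc j)) - ?g (tp j)\<bar>"
        using pm1_mult_power_cases[OF D(6), of j] by (auto simp: abs_minus_commute)
      finally show False by simp
    qed
    have "r \<le> (d / (2 * (b - a))) ^ k"
      unfolding r_def by (rule power_decreasing) (use \<open>k \<le> n\<close> base in auto)
    also have "\<dots> \<le> \<rho>" unfolding \<rho> by (rule descent_ratio_ge[OF data \<open>a < b\<close> d(1) gap])
    finally have "r \<le> \<rho>" .
    then show ?thesis
      unfolding q_def using r \<beta> assms by (intro contraction_factor_le) auto
  qed
  ultimately show ?thesis unfolding Let_def by blast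
qed

section \<open>Lower bound for the best error\<close>

text \<open>At a left end point the error of \<open>\<sigma>\<close> has modulus at least \<beta> M.
  If it outweighs the error of \<open>p\<close> everywhere, then \<open>\<sigma> - p\<close>
  inherits its sign at the points of index 0 to \<open>n + 1\<close>.\<close>

lemma de_la_Vallee_Poussin:
  assumes "a < b" and cont: "continuous_on {a..b} f" and \<sigma>: "\<sigma> \<in> poly_funs n" and p: "p \<in> poly_funs n"
    and data: "alternance_data a b (\<lambda>t. \<sigma> t - f t) \<beta> k \<epsilon> tm tp" and "n + 1 \<le> k"
  shows "\<beta> * max_norm a b (\<lambda>t. \<sigma> t - f t) \<le> max_norm a b (\<lambda>t. p t - f t)"
proof (rule ccontr)
  assume "\<not> ?thesis"
  then have less: "max_norm a b (\<lambda>t. p t - f t) < \<beta> * max_norm a b (\<lambda>t. \<sigma> t - f t)" by simp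
  note D = alternance_dataD[OF data \<open>a < b\<close>]
  have "(\<lambda>t. \<sigma> t - 1 * p t) \<in> poly_funs n" by (rule poly_funs_lincomb[OF \<sigma> p])
  then show False
  proof (rule poly_funs_no_long_alternation)
    show "tm i < tm (Suc i)" if "i \<le> n" for i
      using D(9)[of i] D(10)[of i] that \<open>n + 1 \<le> k\<close> by simp
    show "0 < \<epsilon> * (-1) ^ i * (\<sigma> (tm i) - 1 * p (tm i))" if "i \<le> Suc n" for i
    proof -
      have i: "i \<le> k" using that \<open>n + 1 \<le> k\<close> by simp
      have "tm i \<in> {a..b}" using alternance_data_in_Icc[OF data \<open>a < b\<close> i] D(9)[OF i] by simp
      moreover have "continuous_on {a..b} (\<lambda>t. p t - f t)"
        by (intro continuous_intros cont poly_funs_continuous_on[OF p])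
      ultimately have "\<bar>p (tm i) - f (tm i)\<bar> < \<beta> * max_norm a b (\<lambda>t. \<sigma> t - f t)"
        using abs_le_max_norm less by fastforce
      then show ?thesis
        using alternance_data_alternates[OF data \<open>a < b\<close> i] pm1_mult_power_cases[OF D(6), of i] by auto
    qed
  qed
qed

section \<open>Integer ranks from logarithms\<close>

text \<open>The logarithmic ratio counts the multiplications by \<open>c\<close> still needed to
  reach \<open>\<beta>hi\<close>. Rounding up accounts for the last one, which is truncated by the
  minimum and ends at rank 0.\<close>

lemma nat_ceiling_log_ratio_decreasing:
  fixes \<beta> \<beta>hi c :: real
  assumes "0 < \<beta>" "\<beta> < \<beta>hi" "1 < c"
  shows "nat \<lceil>ln (\<beta>hi / min (c * \<beta>) \<beta>hi) / ln c\<rceil> < nat \<lceil>ln (\<beta>hi / \<beta>) / ln c\<rceil>"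
proof -
  have pos: "0 < ln (\<beta>hi / \<beta>) / ln c" using assms by simp
  show ?thesis
  proof (cases "c * \<beta> \<le> \<beta>hi")
    case True
    have "ln (\<beta>hi / (c * \<beta>)) = ln (\<beta>hi / \<beta>) - ln c"
      using assms by (simp add: ln_div ln_mult)
    then have "ln (\<beta>hi / min (c * \<beta>) \<beta>hi) / ln c = ln (\<beta>hi / \<beta>) / ln c - 1"
      using True assms by (simp add: diff_divide_distrib min_def)
    with pos show ?thesis by linarith
  next
    case False
    with pos show ?thesis by (simp add: min_def)
  qed
qed

text \<open>Counts how many contractions by \<open>q\<close> still fit above the floor
  \<open>E\<close>. Because of \<open>E \<le> x\<close> the logarithm is nonnegative, so
  \<open>nat\<close> cannot hide a decrease.\<close>

lemma nat_floor_log_decreasing: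
  fixes x y E q :: real
  assumes "0 < E" "E \<le> x" "0 < q" "q < 1" "x < q * y"
  shows "nat \<lfloor>ln (x / E) / - ln q\<rfloor> < nat \<lfloor>ln (y / E) / - ln q\<rfloor>"
proof -
  have lq: "0 < - ln q" using assms by simp
  have "0 < q * y" using assms by linarith
  then have y: "0 < y" using assms(3) by (simp add: zero_less_mult_iff)
  have "ln (x / E) < ln (q * y / E)" using assms y by (simp add: divide_strict_right_mono)
  also have "\<dots> = ln (y / E) - - ln q" using assms y by (simp add: ln_div ln_mult)
  finally have "ln (x / E) / - ln q < (ln (y / E) - - ln q) / - ln q" using lq by (rule divide_strict_right_mono)
  also have "\<dots> = ln (y / E) / - ln q - 1"
    by (subst diff_divide_distrib, subst divide_self) (use lq in auto)
  finally have "ln (x / E) / - ln q < ln (y / E) / - ln q - 1" .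
  moreover have "0 \<le> ln (x / E) / - ln q" using assms lq by (intro divide_nonneg_nonneg) auto
  ultimately show ?thesis by linarith
qed

lemma nat_floor_log_mono:
  fixes x y E q :: real
  assumes "0 < E" "0 < x" "0 < q" "q < 1" "x \<le> y"
  shows "nat \<lfloor>ln (x / E) / - ln q\<rfloor> \<le> nat \<lfloor>ln (y / E) / - ln q\<rfloor>"
  using assms by (intro nat_mono floor_mono divide_right_mono) (auto simp: divide_right_mono)

section \<open>Alternance number, invariant and progress\<close>

text \<open>Alternance data include balance, so the centring inside \<open>alternance_number\<close>
  leaves \<open>\<sigma>\<close> unchanged.\<close>

lemma alternance_number_eq:
  assumes "alternance_data a b (\<lambda>t. \<sigma> t - f t) \<beta> k \<epsilon> tm tp" "a < b"
  shows "alternance_number a b f \<beta> \<sigma> = k"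
proof -
  have "centre a b f \<sigma> = \<sigma>" by (rule centre_idem) (rule alternance_dataD(3)[OF assms])
  with assms(1) have ex: "\<exists>\<epsilon> tm tp. alternance_data a b (\<lambda>t. centre a b f \<sigma> t - f t) \<beta> k \<epsilon> tm tp" by metis
  show ?thesis
    unfolding alternance_number_def
  proof (rule the_equality)
    show "\<exists>\<epsilon> tm tp. alternance_data a b (\<lambda>t. centre a b f \<sigma> t - f t) \<beta> k \<epsilon> tm tp" by (rule ex)
    fix k' assume "\<exists>\<epsilon> tm tp. alternance_data a b (\<lambda>t. centre a b f \<sigma> t - f t) \<beta> k' \<epsilon> tm tp"
    with ex show "k' = k" using alternance_data_unique_number[OF _ _ assms(2)] by blast
  qed
qed

text \<open>\<open>B\<close> will be the initial error, which no later iterate exceeds. Balance, a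
  requirement of alternance data, is recorded only for \<open>Inner\<close>: recentring creates it,
  \<open>increase\<close> keeps it, and a descent may destroy it.\<close>

fun alg_inv ::
    "real \<Rightarrow> real \<Rightarrow> (real \<Rightarrow> real) \<Rightarrow> nat \<Rightarrow> real \<Rightarrow> real \<Rightarrow> real \<Rightarrow> alg_state \<Rightarrow> bool" where
  "alg_inv a b f n \<beta>lo \<beta>hi B (Main \<sigma> \<beta>) \<longleftrightarrow>
    \<sigma> \<in> poly_funs n \<and> \<beta> \<in> {\<beta>lo..\<beta>hi} \<and> max_norm a b (\<lambda>t. \<sigma> t - f t) \<le> B"
| "alg_inv a b f n \<beta>lo \<beta>hi B (Inner \<sigma> \<beta>) \<longleftrightarrow>
    \<sigma> \<in> poly_funs n \<and> \<beta> \<in> {\<beta>lo..\<beta>hi} \<and> max_norm a b (\<lambda>t. \<sigma> t - f t) \<le> B \<and>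
    max_on a b (\<lambda>t. \<sigma> t - f t) = - min_on a b (\<lambda>t. \<sigma> t - f t)"
| "alg_inv a b f n \<beta>lo \<beta>hi B (Output \<sigma>) \<longleftrightarrow>
    \<sigma> \<in> poly_funs n \<and> (\<exists>k\<ge>n + 1. \<exists>\<epsilon> tm tp. alternance_data a b (\<lambda>t. \<sigma> t - f t) \<beta>hi k \<epsilon> tm tp)"

lemma poly_funs_diff_continuous_on:
  "continuous_on S f \<Longrightarrow> \<sigma> \<in> poly_funs n \<Longrightarrow> continuous_on S (\<lambda>t. \<sigma> t - f t)"
  by (intro continuous_on_diff) (auto intro: poly_funs_continuous_on)

lemma alg_inv_step:
  assumes step: "alg_step a b f n \<beta>lo \<beta>hi \<gamma>lo \<gamma>hi s s'" and inv: "alg_inv a b f n \<beta>lo \<beta>hi B s"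
    and "a < b" "continuous_on {a..b} f" "0 < \<beta>lo" "\<beta>lo < \<beta>hi" "\<beta>hi < 1" "\<gamma>lo \<le> 1" "1 < \<gamma>hi"
  shows "alg_inv a b f n \<beta>lo \<beta>hi B s'"
  using step
proof cases
  case (recentre \<sigma> \<beta>)
  then have \<sigma>: "\<sigma> \<in> poly_funs n" "\<beta> \<in> {\<beta>lo..\<beta>hi}" "max_norm a b (\<lambda>t. \<sigma> t - f t) \<le> B" using inv by auto
  note c = poly_funs_diff_continuous_on[OF assms(4) \<sigma>(1)]
  have "a \<le> b" using assms by simp
  then show ?thesis
    using recentre poly_funs_centre[OF \<sigma>(1)] \<sigma> max_norm_centre_le[OF _ c] centre_balanced[OF _ c] by auto
next
  case (stop \<sigma> \<beta> k \<epsilon> tm tp)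
  then show ?thesis using inv by auto
next
  case (increase \<sigma> \<beta> k \<epsilon> tm tp)
  then have \<beta>: "\<beta>lo \<le> \<beta>" using inv by simp
  have "1 * \<beta> \<le> \<gamma>hi * \<beta>" using \<beta> assms by (intro mult_right_mono) auto
  with \<beta> have "\<beta>lo \<le> \<gamma>hi * \<beta>" by linarith
  then show ?thesis using increase inv assms by auto
next
  case (descend \<sigma> \<beta> k \<epsilon> tm tp \<gamma> \<rho> l)
  then have \<sigma>: "\<sigma> \<in> poly_funs n" "\<beta>lo \<le> \<beta>" "\<beta> \<le> \<beta>hi" "max_norm a b (\<lambda>t. \<sigma> t - f t) \<le> B" using inv by auto
  note ext = descent_poly_extrema[OF descend(3) \<open>a < b\<close>]
  have "0 \<le> \<rho>" unfolding descend ext(5) using ext(1,2) by simp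
  \<comment> \<open>With \<open>r = 0\<close> the estimate says that the threshold factor is at most
    1, which is enough to stay below \<open>B\<close>.\<close>
  then have "(1 + \<beta> * \<rho>) / (1 + \<rho>) \<le> 1 - (1 - \<beta>hi) * (0 / (1 + 0))"
    by (intro contraction_factor_le) (use \<sigma> assms in auto)
  then have "(1 + \<beta> * \<rho>) / (1 + \<rho>) * max_norm a b (\<lambda>t. \<sigma> t - f t) \<le> 1 * max_norm a b (\<lambda>t. \<sigma> t - f t)"
    by (intro mult_right_mono) (use alternance_dataD(4)[OF descend(3) \<open>a < b\<close>] in auto)
  then have "max_norm a b (\<lambda>t. \<sigma> t - l * \<gamma> t - f t) \<le> B" using descend(8) \<sigma>(4) by (simp add: algebra_simps)
  moreover have "\<gamma> \<in> poly_funs n"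
    using descend(4,5) poly_funs_descent_poly poly_funs_mono by blast
  then have "(\<lambda>t. \<sigma> t - l * \<gamma> t) \<in> poly_funs n" by (rule poly_funs_lincomb[OF \<sigma>(1)])
  moreover have "\<gamma>lo * \<beta> \<le> 1 * \<beta>" using \<sigma> assms by (intro mult_right_mono) auto
  then have "\<gamma>lo * \<beta> \<le> \<beta>hi" using \<sigma>(3) by linarith
  ultimately show ?thesis using descend(2) assms(6) by auto
qed

text \<open>An \<open>Inner\<close> state could be stuck only without alternance data or without an
  admissible step length. Balance and positive error exclude the former,
  \<open>descent_step_exists\<close> the latter.\<close>

lemma alg_step_exists:
  assumes inv: "alg_inv a b f n \<beta>lo \<beta>hi B s" and "\<nexists>\<sigma>. s = Output \<sigma>"
    and "a < b" "continuous_on {a..b} f" "0 < \<beta>lo" "\<beta>hi < 1"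
    and pos: "\<And>\<sigma>. \<sigma> \<in> poly_funs n \<Longrightarrow> 0 < max_norm a b (\<lambda>t. \<sigma> t - f t)"
  shows "\<exists>s'. alg_step a b f n \<beta>lo \<beta>hi \<gamma>lo \<gamma>hi s s'"
proof (cases s)
  case (Main \<sigma> \<beta>)
  then show ?thesis by (blast intro: alg_step.recentre)
next
  case (Inner \<sigma> \<beta>)
  then have \<sigma>: "\<sigma> \<in> poly_funs n" "\<beta>lo \<le> \<beta>" "\<beta> \<le> \<beta>hi"
    "max_on a b (\<lambda>t. \<sigma> t - f t) = - min_on a b (\<lambda>t. \<sigma> t - f t)" using inv by auto
  obtain k \<epsilon> tm tp where data: "alternance_data a b (\<lambda>t. \<sigma> t - f t) \<beta> k \<epsilon> tm tp"
    using alternance_data_exists[OF \<open>a < b\<close> poly_funs_diff_continuous_on[OF assms(4) \<sigma>(1)] \<sigma>(4) pos[OF \<sigma>(1)], of \<beta>]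
      \<sigma> assms(5,6) by auto
  consider "n + 1 \<le> k" "\<beta> = \<beta>hi" | "n + 1 \<le> k" "\<beta> < \<beta>hi" | "k \<le> n" using \<sigma>(3) by linarith
  then show ?thesis
  proof cases
    case 1
    then show ?thesis unfolding Inner using alg_step.stop[OF data] by blast
  next
    case 2
    then show ?thesis unfolding Inner using alg_step.increase[OF data] by blast
  next
    case 3
    obtain l where "0 < l" and "max_norm a b (\<lambda>t. \<sigma> t - f t - l * descent_poly k \<epsilon> tm tp t)
        < (1 + \<beta> * descent_ratio a b k tm tp (descent_poly k \<epsilon> tm tp)) /
          (1 + descent_ratio a b k tm tp (descent_poly k \<epsilon> tm tp)) * max_norm a b (\<lambda>t. \<sigma> t - f t)"
      using descent_step_exists[OF data \<open>a < b\<close>] \<sigma>(3) assms(6) by auto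
    from alg_step.descend[OF data 3 refl refl this] show ?thesis unfolding Inner by blast
  qed
qed (use assms(2) in blast)

section \<open>Lexicographic termination rank\<close>

text \<open>The error comes first because a descent moves back to the earlier phase
  \<open>Main\<close> and may lower \<beta>. Recentring and stopping do not raise the error rank and
  lower the phase; \<open>increase\<close> keeps both and lowers the level.\<close>

fun alg_error_rank :: "real \<Rightarrow> real \<Rightarrow> (real \<Rightarrow> real) \<Rightarrow> real \<Rightarrow> real \<Rightarrow> alg_state \<Rightarrow> nat" where
  "alg_error_rank a b f E q (Main \<sigma> \<beta>) = nat \<lfloor>ln (max_norm a b (\<lambda>t. \<sigma> t - f t) / E) / - ln q\<rfloor>"
| "alg_error_rank a b f E q (Inner \<sigma> \<beta>) = nat \<lfloor>ln (max_norm a b (\<lambda>t. \<sigma> t - f t) / E) / - ln q\<rfloor>"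
| "alg_error_rank a b f E q (Output \<sigma>) = nat \<lfloor>ln (max_norm a b (\<lambda>t. \<sigma> t - f t) / E) / - ln q\<rfloor>"

fun alg_phase_rank :: "alg_state \<Rightarrow> nat" where
  "alg_phase_rank (Main \<sigma> \<beta>) = 2"
| "alg_phase_rank (Inner \<sigma> \<beta>) = 1"
| "alg_phase_rank (Output \<sigma>) = 0"

fun alg_level_rank :: "real \<Rightarrow> real \<Rightarrow> alg_state \<Rightarrow> nat" where
  "alg_level_rank \<beta>hi \<gamma>hi (Main \<sigma> \<beta>) = 0"
| "alg_level_rank \<beta>hi \<gamma>hi (Inner \<sigma> \<beta>) = nat \<lceil>ln (\<beta>hi / \<beta>) / ln \<gamma>hi\<rceil>"
| "alg_level_rank \<beta>hi \<gamma>hi (Output \<sigma>) = 0"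

lemma alg_step_decreases_rank:
  assumes step: "alg_step a b f n \<beta>lo \<beta>hi \<gamma>lo \<gamma>hi s s'" and inv: "alg_inv a b f n \<beta>lo \<beta>hi B s"
    and "a < b" "continuous_on {a..b} f" "0 < \<beta>lo" "1 < \<gamma>hi" "0 < E" "0 < q" "q < 1"
    and E: "\<And>\<sigma>. \<sigma> \<in> poly_funs n \<Longrightarrow> E \<le> max_norm a b (\<lambda>t. \<sigma> t - f t)"
    and q: "\<And>\<sigma> \<beta> k \<epsilon> tm tp \<rho>. \<sigma> \<in> poly_funs n \<Longrightarrow> \<beta> \<in> {\<beta>lo..\<beta>hi} \<Longrightarrow>
      max_norm a b (\<lambda>t. \<sigma> t - f t) \<le> B \<Longrightarrow> alternance_data a b (\<lambda>t. \<sigma> t - f t) \<beta> k \<epsilon> tm tp \<Longrightarrow> k \<le> n \<Longrightarrow>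
      \<rho> = descent_ratio a b k tm tp (descent_poly k \<epsilon> tm tp) \<Longrightarrow> (1 + \<beta> * \<rho>) / (1 + \<rho>) \<le> q"
  shows "(s', s) \<in> measures [alg_error_rank a b f E q, alg_phase_rank, alg_level_rank \<beta>hi \<gamma>hi]"
  using step
proof cases
  case (recentre \<sigma> \<beta>)
  then have \<sigma>: "\<sigma> \<in> poly_funs n" using inv by auto
  have "alg_error_rank a b f E q s' \<le> alg_error_rank a b f E q s"
    unfolding recentre alg_error_rank.simps
    by (rule nat_floor_log_mono)
      (use assms E[OF poly_funs_centre[OF \<sigma>]] max_norm_centre_le poly_funs_diff_continuous_on[OF assms(4) \<sigma>]
        in \<open>auto intro: less_le_trans\<close>)
  moreover have "alg_phase_rank s' < alg_phase_rank s" by (simp add: recentre)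
  ultimately show ?thesis by auto
next
  case (stop \<sigma> \<beta> k \<epsilon> tm tp)
  then show ?thesis by auto
next
  case (increase \<sigma> \<beta> k \<epsilon> tm tp)
  then have "0 < \<beta>" using inv assms by auto
  from nat_ceiling_log_ratio_decreasing[OF this increase(5) \<open>1 < \<gamma>hi\<close>] increase show ?thesis by simp
next
  case (descend \<sigma> \<beta> k \<epsilon> tm tp \<gamma> \<rho> l)
  then have \<sigma>: "\<sigma> \<in> poly_funs n" "\<beta> \<in> {\<beta>lo..\<beta>hi}" "max_norm a b (\<lambda>t. \<sigma> t - f t) \<le> B" using inv by auto
  have "\<gamma> \<in> poly_funs n"
    using descend(4,5) poly_funs_descent_poly poly_funs_mono by blast
  then have \<sigma>': "(\<lambda>t. \<sigma> t - l * \<gamma> t) \<in> poly_funs n" by (rule poly_funs_lincomb[OF \<sigma>(1)])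
  have "(1 + \<beta> * \<rho>) / (1 + \<rho>) \<le> q" by (rule q[OF \<sigma> descend(3,4)]) (use descend in simp)
  then have "(1 + \<beta> * \<rho>) / (1 + \<rho>) * max_norm a b (\<lambda>t. \<sigma> t - f t) \<le> q * max_norm a b (\<lambda>t. \<sigma> t - f t)"
    by (intro mult_right_mono) (use alternance_dataD(4)[OF descend(3) \<open>a < b\<close>] in auto)
  then have "max_norm a b (\<lambda>t. \<sigma> t - l * \<gamma> t - f t) < q * max_norm a b (\<lambda>t. \<sigma> t - f t)"
    using descend(8) by (simp add: algebra_simps)
  from nat_floor_log_decreasing[OF \<open>0 < E\<close> E[OF \<sigma>'] \<open>0 < q\<close> \<open>q < 1\<close> this] descend show ?thesis by simp
qed

section \<open>Termination, progress and quality of the output\<close>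

text \<open>A vanishing error would make a polynomial agree with \<open>f\<close> on [a,b]. The
  positive best error is the floor \<open>E\<close> of the error rank and of the contraction
  estimate.\<close>

lemma best_approx_error_pos:
  assumes "a < b" "continuous_on {a..b} f" "best_approx a b n f p"
    and "\<not> (\<exists>q\<in>poly_funs n. \<forall>t\<in>{a..b}. q t = f t)"
  shows "0 < max_norm a b (\<lambda>t. p t - f t)"
proof (rule ccontr)
  assume "\<not> ?thesis"
  then have le: "max_norm a b (\<lambda>t. p t - f t) \<le> 0" by simp
  have p: "p \<in> poly_funs n" using assms(3) by (simp add: best_approx_def)
  have "p t = f t" if "t \<in> {a..b}" for t
    using abs_le_max_norm[OF poly_funs_diff_continuous_on[OF assms(2) p] that] le by simp
  with assms(4) p show False by blast
qed

theorem theorem3p2: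
  fixes a b \<beta>lo \<beta>hi \<gamma>lo \<gamma>hi \<beta>0 :: real
    and f \<pi>n :: "real \<Rightarrow> real"
    and n :: nat
  assumes "a < b"
    and "n \<ge> 1"
    and "continuous_on {a..b} f"
    and "\<not> (\<exists>q\<in>poly_funs n. \<forall>t\<in>{a..b}. q t = f t)"
    and "best_approx a b n f \<pi>n"
    and "0 < \<beta>lo" and "\<beta>lo < \<beta>hi" and "\<beta>hi < 1"
    and "0 < \<gamma>lo" and "\<gamma>lo \<le> 1" and "1 < \<gamma>hi"
    and "\<beta>0 \<in> {\<beta>lo..\<beta>hi}"
  defines "step \<equiv> alg_step a b f n \<beta>lo \<beta>hi \<gamma>lo \<gamma>hi"
    and "start \<equiv> Main (initial_line a b f) \<beta>0"
  shows "\<not> (\<exists>s :: nat \<Rightarrow> alg_state. s 0 = start \<and> (\<forall>i. step (s i) (s (Suc i))))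
    \<and> (\<forall>s. step\<^sup>*\<^sup>* start s \<longrightarrow> (\<exists>s'. step s s') \<or> (\<exists>\<sigma>. s = Output \<sigma>))
    \<and> (\<forall>\<sigma>. step\<^sup>*\<^sup>* start (Output \<sigma>) \<longrightarrow>
          \<sigma> \<in> poly_funs n
        \<and> alternance_number a b f \<beta>hi \<sigma> \<ge> n + 1
        \<and> \<beta>hi * max_norm a b (\<lambda>t. \<sigma> t - f t) \<le> max_norm a b (\<lambda>t. \<pi>n t - f t))"
proof -
  let ?E = "max_norm a b (\<lambda>t. \<pi>n t - f t)"
  let ?B = "max_norm a b (\<lambda>t. initial_line a b f t - f t)"
  let ?inv = "alg_inv a b f n \<beta>lo \<beta>hi ?B"
  have E: "0 < ?E" by (rule best_approx_error_pos[OF assms(1,3,5,4)])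
  have E_le: "?E \<le> max_norm a b (\<lambda>t. \<sigma> t - f t)" if "\<sigma> \<in> poly_funs n" for \<sigma>
    using assms(5) that unfolding best_approx_def by blast
  \<comment> \<open>One factor \<open>q\<close> serves all reachable states: it is chosen before any
    iterate and depends on them only through the error bounds \<open>?E\<close> and
    \<open>?B\<close>.\<close>
  have "0 < \<beta>hi" using assms(6,7) by simp
  from uniform_contraction[OF assms(1,3) E assms(6) this assms(8), where B = ?B and n = n] obtain q
    where q: "0 < q" "q < 1" "\<forall>\<sigma>\<in>poly_funs n. \<forall>\<beta>\<in>{\<beta>lo..\<beta>hi}. \<forall>k \<epsilon> tm tp.
      ?E \<le> max_norm a b (\<lambda>t. \<sigma> t - f t) \<longrightarrow> max_norm a b (\<lambda>t. \<sigma> t - f t) \<le> ?B \<longrightarrow>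
      alternance_data a b (\<lambda>t. \<sigma> t - f t) \<beta> k \<epsilon> tm tp \<longrightarrow> k \<le> n \<longrightarrow>
      (let \<rho> = descent_ratio a b k tm tp (descent_poly k \<epsilon> tm tp) in (1 + \<beta> * \<rho>) / (1 + \<rho>) \<le> q)"
    by blast
  have start: "?inv start"
    unfolding start_def using assms poly_funs_initial_line by simp
  have inv_step: "?inv s'" if "step s s'" "?inv s" for s s'
    using alg_inv_step[OF that[unfolded step_def]] assms by blast
  have inv: "?inv s" if "step\<^sup>*\<^sup>* start s" for s
    using that by (induction rule: rtranclp_induct) (use start inv_step in auto)
  have decr: "(s', s) \<in> measures [alg_error_rank a b f ?E q, alg_phase_rank, alg_level_rank \<beta>hi \<gamma>hi]"
    if "step s s'" "?inv s" for s s'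
    by (rule alg_step_decreases_rank[OF that[unfolded step_def] assms(1,3,6,11) E q(1,2) E_le])
      (use q(3) E_le in \<open>auto simp: Let_def\<close>)
  show ?thesis
  proof (intro conjI allI impI)
    show "\<not> (\<exists>s. s 0 = start \<and> (\<forall>i. step (s i) (s (Suc i))))"
    proof
      assume "\<exists>s. s 0 = start \<and> (\<forall>i. step (s i) (s (Suc i)))"
      then obtain s where s: "s 0 = start" "\<And>i. step (s i) (s (Suc i))" by blast
      have "?inv (s i)" for i
        by (induction i) (use s start inv_step in auto)
      then have "\<And>i. (s (Suc i), s i) \<in> measures [alg_error_rank a b f ?E q, alg_phase_rank, alg_level_rank \<beta>hi \<gamma>hi]"
        using decr s(2) by blast
      moreover have "wf (measures [alg_error_rank a b f ?E q, alg_phase_rank, alg_level_rank \<beta>hi \<gamma>hi])"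
        by (rule wf_measures)
      ultimately show False unfolding wf_iff_no_infinite_down_chain by blast
    qed
  next
    fix s assume "step\<^sup>*\<^sup>* start s"
    then have "?inv s" by (rule inv)
    then have "\<exists>s'. step s s'" if "\<nexists>\<sigma>. s = Output \<sigma>"
      unfolding step_def
      by (rule alg_step_exists[OF _ that assms(1,3,6,8)]) (rule less_le_trans[OF E E_le])
    then show "(\<exists>s'. step s s') \<or> (\<exists>\<sigma>. s = Output \<sigma>)" by blast
  next
    fix \<sigma> assume "step\<^sup>*\<^sup>* start (Output \<sigma>)"
    then have "?inv (Output \<sigma>)" by (rule inv)
    then obtain k \<epsilon> tm tp where \<sigma>: "\<sigma> \<in> poly_funs n" and "n + 1 \<le> k"
      and data: "alternance_data a b (\<lambda>t. \<sigma> t - f t) \<beta>hi k \<epsilon> tm tp" by auto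
    show "\<sigma> \<in> poly_funs n" by (rule \<sigma>)
    show "n + 1 \<le> alternance_number a b f \<beta>hi \<sigma>"
      using alternance_number_eq[OF data assms(1)] \<open>n + 1 \<le> k\<close> by simp
    have "\<pi>n \<in> poly_funs n" using assms(5) by (simp add: best_approx_def)
    then show "\<beta>hi * max_norm a b (\<lambda>t. \<sigma> t - f t) \<le> ?E"
      by (rule de_la_Vallee_Poussin[OF assms(1,3) \<sigma> _ data \<open>n + 1 \<le> k\<close>])
  qed
qed

end
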